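(* There exists an oracle $\mathcal{V}\subseteq\mathbb{N}$ such that, relative to $\mathcal{V}$, there is no disjoint $\mathsf{CoNP}$ pair that is complete for the class of disjoint $\mathsf{CoNP}$ pairs with respect to polynomial-time reductions, but $\mathsf{E}^{\mathcal{V}}=\mathsf{NE}^{\mathcal{V}}$.
   Context: Relative to an oracle $A$: a disjoint $\mathsf{CoNP}^A$ pair is a pair $(U,V)$ of $\mathsf{CoNP}^A$ sets with $U\cap V=\varnothing$. $(U_0,U_1)$ is polynomially reducible to $(U'_0,U'_1)$ if there is a function $f$ computable in polynomial time with oracle $A$ such that for $i\in\{0,1\}$ and all $n$, $n\in U_i\to f(n)\in U'_i$. A pair is complete if every disjoint $\mathsf{CoNP}^A$ pair reduces to it. $\mathsf{E}^A$ and $\mathsf{NE}^A$ are the classes of languages decidable by deterministic, resp. nondeterministic, oracle machines with oracle $A$ in time $2^{O(n)}$ ($n$ the input length). *)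

theory Defs
  imports Main
begin

text \<open>Numbers are given to machines in binary, most significant bit first and without leading
  zeros; the length of an input is the number of its bits (so \<open>0\<close> has length \<open>0\<close>).\<close>

fun bits :: "nat \<Rightarrow> bool list" where
  "bits n = (if n = 0 then [] else bits (n div 2) @ [odd n])"

declare bits.simps [simp del]

definition nat_of_bits :: "bool list \<Rightarrow> nat" where
  "nat_of_bits w = horner_sum of_bool 2 (rev w)"

lemma nat_of_bits_bits: "nat_of_bits (bits n) = n"
proof (induction n rule: bits.induct)
  case (1 n)
  show ?case
  proof (cases "n = 0")
    case True
    then show ?thesis by (simp add: bits.simps nat_of_bits_def)
  next
    case False
    then have "nat_of_bits (bits n) = of_bool (odd n) + 2 * nat_of_bits (bits (n div 2))"
      by (subst bits.simps) (simp add: nat_of_bits_def)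
    with 1 False show ?thesis by simp
  qed
qed

text \<open>Multi-tape oracle Turing machines. Tapes are infinite to the right only; a left move in
  cell \<open>0\<close> leaves the head where it is. Tape \<open>0\<close> carries the input and, for machines computing
  functions, the output; tape \<open>1\<close> is the query tape. A machine is a finite set of instructions
  (state, symbols read, new state, symbols written with head moves), so that only finitely many
  states and finitely many of the auxiliary symbols are used.\<close>

datatype symb = Blank | Bit bool | Aux nat

datatype dir = Lft | Stay | Rgt

type_synonym tape = "(nat \<Rightarrow> symb) \<times> nat"

type_synonym instr = "nat \<times> symb list \<times> nat \<times> (symb \<times> dir) list"

type_synonym config = "nat \<times> tape list"

record machine =
  num_tapes :: nat
  instrs :: "instr set"
  start_state :: nat
  accept_state :: nat
  query_state :: nat
  yes_state :: nat
  no_state :: nat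

definition oracle_machine :: "machine \<Rightarrow> bool" where
  "oracle_machine M \<longleftrightarrow> 2 \<le> num_tapes M \<and> finite (instrs M) \<and>
     (\<forall>(q, rs, q', as) \<in> instrs M. length rs = num_tapes M \<and> length as = num_tapes M)"

definition deterministic :: "machine \<Rightarrow> bool" where
  "deterministic M \<longleftrightarrow>
     (\<forall>q rs q1 as1 q2 as2. (q, rs, q1, as1) \<in> instrs M \<longrightarrow> (q, rs, q2, as2) \<in> instrs M \<longrightarrow>
        q1 = q2 \<and> as1 = as2)"

fun read :: "tape \<Rightarrow> symb" where
  "read (f, h) = f h"

fun act :: "symb \<times> dir \<Rightarrow> tape \<Rightarrow> tape" where
  "act (s, d) (f, h) =
     (f(h := s), (case d of Lft \<Rightarrow> h - 1 | Stay \<Rightarrow> h | Rgt \<Rightarrow> h + 1))"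

text \<open>The number written on a tape: the value of the maximal block of bits starting in cell \<open>0\<close>.
  Tapes occurring in computations contain only finitely many non-blank cells, so the block is
  finite.\<close>

definition tape_number :: "tape \<Rightarrow> nat" where
  "tape_number T =
     nat_of_bits (map (\<lambda>i. fst T i = Bit True) [0..<(LEAST i. \<forall>b. fst T i \<noteq> Bit b)])"

definition input_tape :: "nat \<Rightarrow> tape" where
  "input_tape x = ((\<lambda>i. if i < length (bits x) then Bit (bits x ! i) else Blank), 0)"

definition blank_tape :: tape where
  "blank_tape = ((\<lambda>i. Blank), 0)"

definition init :: "machine \<Rightarrow> nat \<Rightarrow> config" where
  "init M x = (start_state M, input_tape x # replicate (num_tapes M - 1) blank_tape)"

inductive step :: "machine \<Rightarrow> nat set \<Rightarrow> config \<Rightarrow> config \<Rightarrow> bool" for M A where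
  instr: "\<lbrakk>q \<noteq> query_state M; (q, map read ts, q', as) \<in> instrs M\<rbrakk>
            \<Longrightarrow> step M A (q, ts) (q', map2 act as ts)"
| query: "step M A (query_state M, ts)
            (if tape_number (ts ! 1) \<in> A then yes_state M else no_state M, ts)"

definition halted :: "machine \<Rightarrow> nat set \<Rightarrow> config \<Rightarrow> bool" where
  "halted M A c \<longleftrightarrow> (\<nexists>c'. step M A c c')"

definition reaches :: "machine \<Rightarrow> nat set \<Rightarrow> nat \<Rightarrow> config \<Rightarrow> bool" where
  "reaches M A x c \<longleftrightarrow> (step M A)\<^sup>*\<^sup>* (init M x) c"

definition accepts :: "machine \<Rightarrow> nat set \<Rightarrow> nat \<Rightarrow> bool" where
  "accepts M A x \<longleftrightarrow> (\<exists>c. reaches M A x c \<and> halted M A c \<and> fst c = accept_state M)"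

text \<open>Every computation branch, on every input of length \<open>n\<close>, halts after at most \<open>t n\<close> steps.\<close>

definition runs_in_time :: "machine \<Rightarrow> nat set \<Rightarrow> (nat \<Rightarrow> nat) \<Rightarrow> bool" where
  "runs_in_time M A t \<longleftrightarrow>
     (\<forall>x k c. (step M A ^^ k) (init M x) c \<longrightarrow> k \<le> t (length (bits x)))"

definition DTIME :: "nat set \<Rightarrow> (nat \<Rightarrow> nat) \<Rightarrow> nat set set" where
  "DTIME A t = {{x. accepts M A x} | M.
     oracle_machine M \<and> deterministic M \<and> runs_in_time M A t}"

definition NTIME :: "nat set \<Rightarrow> (nat \<Rightarrow> nat) \<Rightarrow> nat set set" where
  "NTIME A t = {{x. accepts M A x} | M. oracle_machine M \<and> runs_in_time M A t}"

text \<open>The additive constants in the time bounds only matter for inputs of length \<open>0\<close> and \<open>1\<close>.\<close>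

definition E :: "nat set \<Rightarrow> nat set set" where
  "E A = (\<Union>c. DTIME A (\<lambda>n. 2 ^ (c * n + c)))"

definition NE :: "nat set \<Rightarrow> nat set set" where
  "NE A = (\<Union>c. NTIME A (\<lambda>n. 2 ^ (c * n + c)))"

definition NP :: "nat set \<Rightarrow> nat set set" where
  "NP A = (\<Union>c. NTIME A (\<lambda>n. n ^ c + c))"

definition CoNP :: "nat set \<Rightarrow> nat set set" where
  "CoNP A = {U. - U \<in> NP A}"

definition poly_time_computable :: "nat set \<Rightarrow> (nat \<Rightarrow> nat) \<Rightarrow> bool" where
  "poly_time_computable A f \<longleftrightarrow>
     (\<exists>M c. oracle_machine M \<and> deterministic M \<and> runs_in_time M A (\<lambda>n. n ^ c + c) \<and>
        (\<forall>x. \<exists>d. reaches M A x d \<and> halted M A d \<and> tape_number (snd d ! 0) = f x))"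

definition disjoint_CoNP_pair :: "nat set \<Rightarrow> nat set \<times> nat set \<Rightarrow> bool" where
  "disjoint_CoNP_pair A P \<longleftrightarrow> fst P \<in> CoNP A \<and> snd P \<in> CoNP A \<and> fst P \<inter> snd P = {}"

definition poly_reducible :: "nat set \<Rightarrow> nat set \<times> nat set \<Rightarrow> nat set \<times> nat set \<Rightarrow> bool" where
  "poly_reducible A P Q \<longleftrightarrow>
     (\<exists>f. poly_time_computable A f \<and>
        (\<forall>n. (n \<in> fst P \<longrightarrow> f n \<in> fst Q) \<and> (n \<in> snd P \<longrightarrow> f n \<in> snd Q)))"

definition complete_disjoint_CoNP_pair :: "nat set \<Rightarrow> nat set \<times> nat set \<Rightarrow> bool" where
  "complete_disjoint_CoNP_pair A Q \<longleftrightarrow>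
     disjoint_CoNP_pair A Q \<and> (\<forall>P. disjoint_CoNP_pair A P \<longrightarrow> poly_reducible A P Q)"

end

theory Submission
  imports Defs "HOL-Library.Countable_Set" "HOL-Library.Disjoint_Sets"
begin

text \<open>Every set \<open>W\<close> of numbers determines a set \<open>V\<close> that agrees with \<open>W\<close> except on coding numbers. A
  coding number for a machine \<open>M\<close> and an input \<open>x\<close> has a binary expansion padded to exponential
  length, and it belongs to \<open>V\<close> iff \<open>M\<close> accepts \<open>x\<close> relative to \<open>V\<close> in fewer steps than that length;
  such a computation only queries smaller numbers, so the recursion is well founded. One query then
  decides a language in \<open>NE\<close>, whence \<open>E = NE\<close>.

  It remains to choose \<open>W\<close>, by finite extensions. Let a candidate pair be given by the complements
  of the languages of \<open>M\<^sub>0\<close> and \<open>M\<^sub>1\<close>, and let \<open>U\<^sub>s\<close> be the set of those \<open>x\<close> for which \<open>V\<close> contains no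
  witness \<open>(s, x, y)\<close> with \<open>y\<close> as long as \<open>x\<close>. To defeat a reduction \<open>f\<close>, work with inputs of a large
  length \<open>n\<close>. Because of the padding, only polynomially many coding numbers can be queried by the
  machines involved, and all of them can be frozen by fixing polynomially many witnesses. Some input
  \<open>x\<close> is untouched by this; remove all its witnesses and let \<open>z = f x\<close>. If some \<open>M\<^sub>s\<close> accepts \<open>z\<close>,
  add a witness for \<open>x\<close> on the other side that was not queried: now \<open>x\<close> lies in \<open>U\<^sub>s\<close> but \<open>z\<close>
  is not in the corresponding component of the candidate. If neither accepts, then \<open>z\<close> lies in both
  components, so the candidate is not disjoint. As long as this does not happen, every input keeps
  a witness on one side, and \<open>(U\<^sub>0, U\<^sub>1)\<close> is disjoint.\<close>

section \<open>Binary words\<close>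

lemma nat_of_bits_Nil [simp]: "nat_of_bits [] = 0"
  by (simp add: nat_of_bits_def)

lemma nat_of_bits_snoc [simp]: "nat_of_bits (w @ [b]) = 2 * nat_of_bits w + of_bool b"
  by (simp add: nat_of_bits_def)

lemma nat_of_bits_less: "nat_of_bits w < 2 ^ length w"
  by (induction w rule: rev_induct) auto

lemma nat_of_bits_True_pos: "0 < nat_of_bits (True # w)"
proof (induction w rule: rev_induct)
  case Nil
  show ?case using nat_of_bits_snoc[of "[]" True] by simp
next
  case (snoc b w)
  then show ?case using nat_of_bits_snoc[of "True # w" b] by simp
qed

lemma bits_nat_of_bits: "bits (nat_of_bits (True # w)) = True # w"
proof (induction w rule: rev_induct)
  case Nil
  show ?case using nat_of_bits_snoc[of "[]" True] by (simp add: bits.simps)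
next
  case (snoc b w)
  have "bits (2 * nat_of_bits (True # w) + of_bool b) = bits (nat_of_bits (True # w)) @ [b]"
    using nat_of_bits_True_pos[of w] by (subst bits.simps) (cases b; simp)
  then show ?case using snoc nat_of_bits_snoc[of "True # w" b] by simp
qed

lemma bits_inject [simp]: "bits x = bits y \<longleftrightarrow> x = y"
  by (metis nat_of_bits_bits)

abbreviation bit_length :: "nat \<Rightarrow> nat" where
  "bit_length x \<equiv> length (bits x)"

lemma bit_length_le_iff: "bit_length x \<le> k \<longleftrightarrow> x < 2 ^ k"
proof
  assume "bit_length x \<le> k"
  have "x < 2 ^ bit_length x" using nat_of_bits_less[of "bits x"] by (simp add: nat_of_bits_bits)
  also have "\<dots> \<le> 2 ^ k" using \<open>bit_length x \<le> k\<close> by simp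
  finally show "x < 2 ^ k" .
next
  show "x < 2 ^ k \<Longrightarrow> bit_length x \<le> k"
  proof (induction k arbitrary: x)
    case 0
    then show ?case by (simp add: bits.simps)
  next
    case (Suc k)
    then have "bit_length (x div 2) \<le> k" by auto
    then show ?case by (subst bits.simps) simp
  qed
qed

lemma less_bit_length_iff: "k < bit_length x \<longleftrightarrow> 2 ^ k \<le> x"
  using bit_length_le_iff[of x k] by linarith

lemma bit_length_eq_Suc_iff: "bit_length x = Suc n \<longleftrightarrow> x \<in> {2 ^ n..<2 ^ Suc n}"
  using less_bit_length_iff[of n x] bit_length_le_iff[of x "Suc n"] by auto

definition tag_word :: "nat \<Rightarrow> bool list" where
  "tag_word k = replicate (Suc k) True @ [False]"

definition tagged :: "nat \<Rightarrow> bool list \<Rightarrow> nat" where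
  "tagged k w = nat_of_bits (tag_word k @ w)"

lemma bits_tagged: "bits (tagged k w) = tag_word k @ w"
  unfolding tagged_def tag_word_def
  using bits_nat_of_bits[of "replicate k True @ False # w"] by simp

lemma bit_length_tagged: "bit_length (tagged k w) = k + 2 + length w"
  by (simp add: bits_tagged tag_word_def)

lemma replicate_append_Cons_eq_iff:
  assumes "a \<noteq> b"
  shows "replicate k a @ b # w = replicate k' a @ b # w' \<longleftrightarrow> k = k' \<and> w = w'"
proof (induction k arbitrary: k')
  case 0
  show ?case using assms by (cases k') auto
next
  case (Suc k)
  then show ?case using assms by (cases k') auto
qed

lemma tagged_eq_iff [simp]: "tagged k w = tagged k' w' \<longleftrightarrow> k = k' \<and> w = w'"
proof -
  have "tagged k w = tagged k' w' \<longleftrightarrow> tag_word k @ w = tag_word k' @ w'"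
    by (metis bits_tagged bits_inject)
  then show ?thesis
    using replicate_append_Cons_eq_iff[of True False "Suc k" w "Suc k'" w']
    by (simp add: tag_word_def)
qed

lemma tagged_less: "tagged k w < 2 ^ (k + 2 + length w)"
  using bit_length_le_iff[of "tagged k w" "k + 2 + length w"] by (simp add: bit_length_tagged)

lemma tagged_ge: "2 ^ (k + 1 + length w) \<le> tagged k w"
  using less_bit_length_iff[of "k + 1 + length w" "tagged k w"] by (simp add: bit_length_tagged)

lemma splice_snoc:
  "length xs = length ys \<Longrightarrow> splice (xs @ [x]) (ys @ [y]) = splice xs ys @ [x, y]"
  by (induction xs ys rule: list_induct2) simp_all

lemma splice_eq_splice_iff:
  assumes "length xs = length ys" "length xs' = length ys'"
  shows "splice xs ys = splice xs' ys' \<longleftrightarrow> xs = xs' \<and> ys = ys'"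
  using assms
proof (induction xs ys arbitrary: xs' ys' rule: list_induct2)
  case Nil
  then show ?case by (metis length_0_conv split_Nil_iff)
next
  case (Cons x xs y ys)
  show ?case
  proof (cases xs')
    case (Cons x' zs')
    then obtain y' us' where "ys' = y' # us'" "length zs' = length us'"
      using Cons Cons.prems(1) by (cases ys') auto
    then show ?thesis using Cons Cons.IH[of zs' us'] by auto
  qed (use Cons.prems in simp)
qed

section \<open>Agreement of oracles\<close>

definition agree_on :: "'a set \<Rightarrow> 'a set \<Rightarrow> 'a set \<Rightarrow> bool" where
  "agree_on Q A B \<longleftrightarrow> (\<forall>u\<in>Q. u \<in> A \<longleftrightarrow> u \<in> B)"

lemma agree_on_refl [simp]: "agree_on Q A A"
  by (simp add: agree_on_def)

lemma agree_on_sym: "agree_on Q A B \<Longrightarrow> agree_on Q B A"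
  by (simp add: agree_on_def)

lemma agree_on_trans: "\<lbrakk>agree_on Q A B; agree_on Q B C\<rbrakk> \<Longrightarrow> agree_on Q A C"
  by (simp add: agree_on_def)

lemma agree_on_subset: "\<lbrakk>agree_on Q A B; P \<subseteq> Q\<rbrakk> \<Longrightarrow> agree_on P A B"
  by (auto simp: agree_on_def)

lemma agree_on_Un [simp]: "agree_on (P \<union> Q) A B \<longleftrightarrow> agree_on P A B \<and> agree_on Q A B"
  by (auto simp: agree_on_def)

text \<open>This plays two roles: \<open>Q\<close> is the set of queries of a run, or an initial segment \<open>{..<B}\<close> that
  is fixed by a forcing condition.\<close>

definition certifies :: "'a set \<Rightarrow> 'a set \<Rightarrow> ('a set \<Rightarrow> bool) \<Rightarrow> bool" where
  "certifies Q A \<Phi> \<longleftrightarrow> (\<forall>B. agree_on Q A B \<longrightarrow> \<Phi> B)"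

lemma certifiesD: "\<lbrakk>certifies Q A \<Phi>; agree_on Q A B\<rbrakk> \<Longrightarrow> \<Phi> B"
  by (simp add: certifies_def)

lemma certifies_mono:
  assumes "certifies Q A \<Phi>" "Q \<subseteq> Q'" "agree_on Q A A'" "\<And>B. \<Phi> B \<Longrightarrow> \<Psi> B"
  shows "certifies Q' A' \<Psi>"
  using assms unfolding certifies_def by (meson agree_on_subset agree_on_trans)

section \<open>Runs and their queries\<close>

lemma right_unique_relpowp_terminal:
  assumes "right_unique R" "(R ^^ N) a c" "\<nexists>c'. R c c'" "(R ^^ k) a d"
  shows "k \<le> N \<and> (R ^^ (N - k)) d c"
  using assms(4)
proof (induction k arbitrary: d)
  case 0
  then show ?case using assms(2) by simp
next
  case (Suc k)
  then obtain d' where "(R ^^ k) a d'" and step: "R d' d" by auto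
  then have earlier: "k \<le> N" "(R ^^ (N - k)) d' c" using Suc.IH by auto
  show ?case
  proof (cases "N - k")
    case 0
    then show ?thesis using earlier(2) step assms(3) by simp
  next
    case (Suc m)
    then obtain d'' where "R d' d''" "(R ^^ m) d'' c" using earlier(2) by (metis relpowp_Suc_D2)
    moreover have "m = N - Suc k" "Suc k \<le> N" using Suc by auto
    ultimately show ?thesis using right_uniqueD[OF assms(1) step] by blast
  qed
qed

lemma right_unique_terminal_unique:
  assumes "right_unique R" "R\<^sup>*\<^sup>* a c" "\<nexists>c'. R c c'" "R\<^sup>*\<^sup>* a d" "\<nexists>d'. R d d'"
  shows "c = d"
proof -
  obtain N k where run: "(R ^^ N) a c" "(R ^^ k) a d"
    using assms(2,4) by (meson rtranclp_imp_relpowp)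
  have "k \<le> N" "(R ^^ (N - k)) d c"
    using right_unique_relpowp_terminal[OF assms(1) run(1) assms(3) run(2)] by auto
  moreover have "N \<le> k"
    using right_unique_relpowp_terminal[OF assms(1) run(2) assms(5) run(1)] by auto
  ultimately show ?thesis by simp
qed

lemma exists_relpowp_until_terminal:
  "\<exists>k\<le>t. \<exists>c. (R ^^ k) a c \<and> ((\<nexists>c'. R c c') \<or> k = t)"
proof (induction t)
  case (Suc t)
  then obtain k c where run: "k \<le> t" "(R ^^ k) a c" "(\<nexists>c'. R c c') \<or> k = t" by blast
  show ?case
  proof (cases "\<exists>c'. R c c'")
    case True
    then obtain c' where "(R ^^ Suc k) a c'" using run(2) by auto
    then show ?thesis using True run by blast
  qed (use run in \<open>meson le_SucI\<close>)
qed auto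

lemma right_unique_step: "deterministic M \<Longrightarrow> right_unique (step M A)"
proof (rule right_uniqueI)
  fix c d d'
  assume M: "deterministic M" and "step M A c d" "step M A c d'"
  from this(2) show "d = d'"
  proof cases
    case (instr q ts q1 as1)
    obtain q2 as2 where instr': "(q, map read ts, q2, as2) \<in> instrs M" "d' = (q2, map2 act as2 ts)"
      using \<open>step M A c d'\<close> instr by (auto elim: step.cases)
    have "q1 = q2 \<and> as1 = as2"
      using M instr(4) instr'(1) unfolding deterministic_def by blast
    then show ?thesis using instr(2) instr'(2) by simp
  next
    case query
    then show ?thesis using \<open>step M A c d'\<close> by (auto elim!: step.cases)
  qed
qed

lemma halted_cong: "halted M A c \<longleftrightarrow> halted M B c"
proof -
  have "\<exists>c'. step M B c c'" if "step M A c c'" for A B c'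
    using that by cases (blast intro: step.intros)+
  then show ?thesis unfolding halted_def by blast
qed

definition accepts_within :: "machine \<Rightarrow> nat set \<Rightarrow> nat \<Rightarrow> nat \<Rightarrow> bool" where
  "accepts_within M A x t \<longleftrightarrow>
     (\<exists>k\<le>t. \<exists>c. (step M A ^^ k) (init M x) c \<and> halted M A c \<and> fst c = accept_state M)"

lemma accepts_within_imp_accepts: "accepts_within M A x t \<Longrightarrow> accepts M A x"
  unfolding accepts_within_def accepts_def reaches_def by (meson relpowp_imp_rtranclp)

lemma accepts_within_iff:
  assumes "runs_in_time M A t" "t (bit_length x) \<le> u"
  shows "accepts_within M A x u \<longleftrightarrow> accepts M A x"
proof
  assume "accepts M A x"
  then obtain k c where "(step M A ^^ k) (init M x) c" "halted M A c" "fst c = accept_state M"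
    unfolding accepts_def reaches_def by (meson rtranclp_imp_relpowp)
  moreover from this have "k \<le> u"
    using assms unfolding runs_in_time_def by (meson le_trans)
  ultimately show "accepts_within M A x u" unfolding accepts_within_def by blast
qed (rule accepts_within_imp_accepts)

definition clocked_output :: "machine \<Rightarrow> nat set \<Rightarrow> nat \<Rightarrow> nat \<Rightarrow> nat \<Rightarrow> bool" where
  "clocked_output M A x t z \<longleftrightarrow>
     (\<exists>k\<le>t. \<exists>c. (step M A ^^ k) (init M x) c \<and> (halted M A c \<or> k = t) \<and>
        tape_number (snd c ! 0) = z)"

lemma exists_clocked_output: "\<exists>z. clocked_output M A x t z"
  using exists_relpowp_until_terminal[of t "step M A" "init M x"]
  unfolding clocked_output_def halted_def by blast

lemma clocked_output_unique:
  assumes "deterministic M" "runs_in_time M A t" "t (bit_length x) < u"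
    "reaches M A x d" "halted M A d" "clocked_output M A x u z"
  shows "z = tape_number (snd d ! 0)"
proof -
  obtain k c where run: "(step M A ^^ k) (init M x) c" "halted M A c \<or> k = u"
    and tape_value: "tape_number (snd c ! 0) = z"
    using assms(6) unfolding clocked_output_def by blast
  have "k < u" using assms(2,3) run(1) unfolding runs_in_time_def by (meson le_less_trans)
  then have "halted M A c" using run(2) by simp
  then have "c = d"
    using right_unique_terminal_unique[OF right_unique_step[OF assms(1)]] assms(4,5) run(1)
    unfolding halted_def reaches_def by (meson relpowp_imp_rtranclp)
  then show ?thesis using tape_value by simp
qed

definition tapes_bounded :: "machine \<Rightarrow> nat \<Rightarrow> nat \<Rightarrow> config \<Rightarrow> bool" where
  "tapes_bounded M n k c \<longleftrightarrow> length (snd c) = num_tapes M \<and>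
     (\<forall>j<num_tapes M. snd (snd c ! j) \<le> k \<and>
        (\<forall>i\<ge>(if j = 0 then n else 0) + k. fst (snd c ! j) i = Blank))"

lemma tapes_bounded_init:
  assumes "oracle_machine M"
  shows "tapes_bounded M (bit_length x) 0 (init M x)"
proof -
  have "(input_tape x # replicate (num_tapes M - 1) blank_tape) ! j =
      (if j = 0 then input_tape x else blank_tape)" if "j < num_tapes M" for j
    using that by (cases j) auto
  then show ?thesis using assms
    by (auto simp: tapes_bounded_def init_def oracle_machine_def input_tape_def blank_tape_def)
qed

lemma act_bounded:
  assumes "snd T \<le> k" "\<forall>i\<ge>n + k. fst T i = Blank"
  shows "snd (act a T) \<le> Suc k \<and> (\<forall>i\<ge>n + Suc k. fst (act a T) i = Blank)"
  using assms by (cases a; cases T) (auto split: dir.split)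

lemma tapes_bounded_step:
  assumes "oracle_machine M" "tapes_bounded M n k c" "step M A c c'"
  shows "tapes_bounded M n (Suc k) c'"
  using assms(3)
proof cases
  case (instr q ts q' as)
  then have len: "length as = num_tapes M" "length ts = num_tapes M"
    using assms(1,2) by (auto simp: oracle_machine_def tapes_bounded_def)
  have "snd (snd c' ! j) \<le> Suc k \<and>
      (\<forall>i\<ge>(if j = 0 then n else 0) + Suc k. fst (snd c' ! j) i = Blank)"
    if "j < num_tapes M" for j
  proof -
    have "snd c' ! j = act (as ! j) (ts ! j)" using instr len that by simp
    moreover have "snd (ts ! j) \<le> k" "\<forall>i\<ge>(if j = 0 then n else 0) + k. fst (ts ! j) i = Blank"
      using instr assms(2) that by (auto simp: tapes_bounded_def)
    ultimately show ?thesis using act_bounded by metis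
  qed
  then show ?thesis unfolding tapes_bounded_def using instr len by simp
next
  case query
  then show ?thesis using assms(2) by (fastforce simp: tapes_bounded_def)
qed

lemma tapes_bounded_run:
  assumes "oracle_machine M"
  shows "(step M A ^^ k) (init M x) c \<Longrightarrow> tapes_bounded M (bit_length x) k c"
  by (induction k arbitrary: c)
    (auto simp: tapes_bounded_init assms intro: tapes_bounded_step[OF assms])

lemma tape_number_less:
  assumes "fst T k = Blank"
  shows "tape_number T < 2 ^ k"
proof -
  let ?m = "LEAST i. \<forall>b. fst T i \<noteq> Bit b"
  have "tape_number T < 2 ^ ?m"
    using nat_of_bits_less[of "map (\<lambda>i. fst T i = Bit True) [0..<?m]"]
    by (simp add: tape_number_def)
  also have "?m \<le> k" using assms by (intro Least_le) simp
  then have "(2::nat) ^ ?m \<le> 2 ^ k" by simp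
  finally show ?thesis .
qed

lemma query_less:
  assumes "oracle_machine M" "(step M A ^^ k) (init M x) c"
  shows "tape_number (snd c ! 1) < 2 ^ k"
  using tapes_bounded_run[OF assms] assms(1)
  by (intro tape_number_less) (auto simp: tapes_bounded_def oracle_machine_def)

lemma bit_length_clocked_output:
  assumes "oracle_machine M" "clocked_output M A x t z"
  shows "bit_length z \<le> bit_length x + t"
proof -
  obtain k c where run: "k \<le> t" "(step M A ^^ k) (init M x) c"
    and tape_value: "tape_number (snd c ! 0) = z"
    using assms(2) unfolding clocked_output_def by blast
  have "tape_number (snd c ! 0) < 2 ^ (bit_length x + k)"
    using tapes_bounded_run[OF assms(1) run(2)] assms(1)
    by (intro tape_number_less) (auto simp: tapes_bounded_def oracle_machine_def)
  then have "bit_length z \<le> bit_length x + k" by (simp add: bit_length_le_iff tape_value)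
  then show ?thesis using run(1) by simp
qed

definition small_certificate :: "nat \<Rightarrow> nat set \<Rightarrow> nat set \<Rightarrow> (nat set \<Rightarrow> bool) \<Rightarrow> bool" where
  "small_certificate k Q A \<Phi> \<longleftrightarrow> finite Q \<and> card Q \<le> k \<and> Q \<subseteq> {..<2 ^ k} \<and> certifies Q A \<Phi>"

lemma small_certificate_mono:
  assumes "small_certificate k Q A \<Phi>" "k \<le> t" "\<And>B. \<Phi> B \<Longrightarrow> \<Psi> B"
  shows "small_certificate t Q A \<Psi>"
proof -
  have "{..<2 ^ k} \<subseteq> {..<2 ^ t :: nat}" using assms(2) by simp
  moreover have "certifies Q A \<Psi>"
    using assms(1,3) by (simp add: small_certificate_def certifies_def)
  ultimately show ?thesis using assms(1,2) unfolding small_certificate_def by (meson order_trans)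
qed

lemma exists_run_certificate:
  assumes "oracle_machine M"
  shows "(step M A ^^ k) (init M x) c \<Longrightarrow>
    \<exists>Q. small_certificate k Q A (\<lambda>B. (step M B ^^ k) (init M x) c)"
proof (induction k arbitrary: c)
  case 0
  then show ?case by (intro exI[of _ "{}"]) (simp add: small_certificate_def certifies_def)
next
  case (Suc k)
  then obtain d where run: "(step M A ^^ k) (init M x) d" and step: "step M A d c" by auto
  from Suc.IH[OF run] obtain Q
    where certificate: "small_certificate k Q A (\<lambda>B. (step M B ^^ k) (init M x) d)" by blast
  let ?u = "tape_number (snd d ! 1)"
  have same_step: "step M B d c" if "?u \<in> A \<longleftrightarrow> ?u \<in> B" for B
    using step
  proof cases
    case (query ts)
    then show ?thesis using step.query[of M B ts] that by simp
  qed (auto intro: step.instr)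
  have "(step M B ^^ Suc k) (init M x) c" if "agree_on (insert ?u Q) A B" for B
  proof -
    have "(step M B ^^ k) (init M x) d"
      using certificate that by (auto simp: small_certificate_def certifies_def agree_on_def)
    then show ?thesis using same_step[of B] that by (auto simp: agree_on_def)
  qed
  moreover have "?u < 2 ^ Suc k" using query_less[OF assms run] by simp
  then have "insert ?u Q \<subseteq> {..<2 ^ Suc k}"
    using certificate by (fastforce simp: small_certificate_def)
  ultimately have "small_certificate (Suc k) (insert ?u Q) A (\<lambda>B. (step M B ^^ Suc k) (init M x) c)"
    using certificate unfolding small_certificate_def certifies_def by (auto simp: card_insert_if)
  then show ?case by blast
qed

lemma exists_accepts_within_certificate:
  assumes "oracle_machine M" "accepts_within M A x t"
  shows "\<exists>Q. small_certificate t Q A (\<lambda>B. accepts_within M B x t)"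
proof -
  obtain k c where run: "k \<le> t" "(step M A ^^ k) (init M x) c"
    and "halted M A c" "fst c = accept_state M"
    using assms(2) unfolding accepts_within_def by blast
  then have "(step M B ^^ k) (init M x) c \<Longrightarrow> accepts_within M B x t" for B
    unfolding accepts_within_def using halted_cong by blast
  then show ?thesis using exists_run_certificate[OF assms(1) run(2)] run(1) small_certificate_mono
    by meson
qed

lemma exists_clocked_output_certificate:
  assumes "oracle_machine M" "clocked_output M A x t z"
  shows "\<exists>Q. small_certificate t Q A (\<lambda>B. clocked_output M B x t z)"
proof -
  obtain k c where run: "k \<le> t" "(step M A ^^ k) (init M x) c"
    and "halted M A c \<or> k = t" "tape_number (snd c ! 0) = z"
    using assms(2) unfolding clocked_output_def by blast
  then have "(step M B ^^ k) (init M x) c \<Longrightarrow> clocked_output M B x t z" for B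
    unfolding clocked_output_def using halted_cong by blast
  then show ?thesis using exists_run_certificate[OF assms(1) run(2)] run(1) small_certificate_mono
    by meson
qed

lemma accepts_within_cong:
  assumes "oracle_machine M" "agree_on {..<2 ^ t} A B"
  shows "accepts_within M A x t \<longleftrightarrow> accepts_within M B x t"
proof -
  have "accepts_within M B x t" if "accepts_within M A x t" "agree_on {..<2 ^ t} A B" for A B
    using exists_accepts_within_certificate[OF assms(1) that(1)] that(2)
    unfolding small_certificate_def by (meson agree_on_subset certifiesD)
  then show ?thesis using assms(2) agree_on_sym by blast
qed

section \<open>Growth rates\<close>

definition poly_bounded :: "(nat \<Rightarrow> nat) \<Rightarrow> bool" where
  "poly_bounded f \<longleftrightarrow> (\<exists>m. \<forall>n\<ge>2. f n \<le> n ^ m)"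

lemma poly_bounded_const: "poly_bounded (\<lambda>n. c)"
  unfolding poly_bounded_def
proof (intro exI[of _ c] allI impI)
  fix n :: nat assume "2 \<le> n"
  have "c \<le> 2 ^ c" by simp
  also have "\<dots> \<le> n ^ c" using \<open>2 \<le> n\<close> by (rule power_mono) simp
  finally show "c \<le> n ^ c" .
qed

lemma poly_bounded_ident: "poly_bounded (\<lambda>n. n)"
  unfolding poly_bounded_def by (intro exI[of _ 1]) simp

lemma poly_bounded_add:
  assumes "poly_bounded f" "poly_bounded g"
  shows "poly_bounded (\<lambda>n. f n + g n)"
proof -
  obtain i j where bounds: "\<And>n. 2 \<le> n \<Longrightarrow> f n \<le> n ^ i" "\<And>n. 2 \<le> n \<Longrightarrow> g n \<le> n ^ j"
    using assms unfolding poly_bounded_def by blast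
  have "f n + g n \<le> n ^ Suc (i + j)" if "2 \<le> n" for n
  proof -
    have "n ^ i \<le> n ^ (i + j)" "n ^ j \<le> n ^ (i + j)" using that by (auto intro: power_increasing)
    then have "f n + g n \<le> 2 * n ^ (i + j)" using bounds[OF that] by linarith
    also have "\<dots> \<le> n * n ^ (i + j)" using that by (rule mult_le_mono1)
    finally show ?thesis by simp
  qed
  then show ?thesis unfolding poly_bounded_def by blast
qed

lemma poly_bounded_mult:
  assumes "poly_bounded f" "poly_bounded g"
  shows "poly_bounded (\<lambda>n. f n * g n)"
proof -
  obtain i j where "\<And>n. 2 \<le> n \<Longrightarrow> f n \<le> n ^ i" "\<And>n. 2 \<le> n \<Longrightarrow> g n \<le> n ^ j"
    using assms unfolding poly_bounded_def by blast
  then have "f n * g n \<le> n ^ (i + j)" if "2 \<le> n" for n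
    using that by (simp add: power_add mult_le_mono)
  then show ?thesis unfolding poly_bounded_def by blast
qed

lemma poly_bounded_power: "poly_bounded f \<Longrightarrow> poly_bounded (\<lambda>n. f n ^ c)"
  by (induction c) (auto intro: poly_bounded_const poly_bounded_mult)

lemmas poly_bounded_intros =
  poly_bounded_const poly_bounded_ident poly_bounded_add poly_bounded_mult poly_bounded_power

definition clock :: "nat \<Rightarrow> nat \<Rightarrow> nat" where
  "clock c n = n ^ c + c"

lemma poly_bounded_clock: "poly_bounded f \<Longrightarrow> poly_bounded (\<lambda>n. clock c (f n))"
  unfolding clock_def by (intro poly_bounded_intros)

lemma poly_bounded_imp_le_clock:
  assumes "poly_bounded f"
  shows "\<exists>c. \<forall>n. f n \<le> clock c n"
proof -
  obtain m where bound: "\<And>n. 2 \<le> n \<Longrightarrow> f n \<le> n ^ m"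
    using assms unfolding poly_bounded_def by blast
  define c where "c = m + f 0 + f 1"
  have "f n \<le> n ^ c + c" for n
  proof (cases "2 \<le> n")
    case True
    then have "n ^ m \<le> n ^ c" by (intro power_increasing) (auto simp: c_def)
    then show ?thesis using bound[OF True] by linarith
  next
    case False
    then have "n = 0 \<or> n = 1" by linarith
    then show ?thesis by (auto simp: c_def)
  qed
  then show ?thesis unfolding clock_def by blast
qed

lemma clock_mono_exponent:
  assumes "c \<le> c'"
  shows "clock c n \<le> clock c' n"
proof (cases "n = 0 \<and> c < c'")
  case True
  then show ?thesis by (cases c) (auto simp: clock_def)
next
  case False
  then have "n ^ c \<le> n ^ c'"
    using assms by (cases "c = c'") (auto intro: power_increasing)
  then show ?thesis using assms by (simp add: clock_def)
qed

lemma clock_mono: "m \<le> n \<Longrightarrow> clock c m \<le> clock c n"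
  unfolding clock_def by (intro add_mono power_mono) auto

lemma square_less_exp:
  assumes "5 \<le> i"
  shows "i * i < (2::nat) ^ i"
  using assms
proof (induction i rule: dec_induct)
  case (step i)
  have "5 * i \<le> i * i" using step by (intro mult_le_mono1) simp
  then have "Suc i * Suc i \<le> 2 * (i * i)"
    using step(1) unfolding mult_Suc mult_Suc_right by linarith
  then show ?case using step by simp
qed simp

lemma poly_bounded_less_exp:
  assumes "poly_bounded f"
  shows "\<exists>n\<ge>B. f n < 2 ^ n"
proof -
  obtain m where bound: "\<And>n. 2 \<le> n \<Longrightarrow> f n \<le> n ^ m"
    using assms unfolding poly_bounded_def by blast
  define j where "j = m + B + 5"
  have "f (2 ^ j) \<le> (2 ^ j) ^ m" by (rule bound) (simp add: j_def power_add)
  also have "\<dots> = 2 ^ (j * m)" by (simp add: power_mult)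
  also have "\<dots> \<le> 2 ^ (j * j)" by (rule power_increasing) (auto simp: j_def)
  also have "\<dots> < 2 ^ (2 ^ j)" using square_less_exp[of j] by (simp add: j_def)
  finally have "f (2 ^ j) < 2 ^ (2 ^ j)" .
  moreover have "B \<le> 2 ^ j" using less_exp[of j] j_def by linarith
  ultimately show ?thesis by blast
qed

definition exp_bounded :: "(nat \<Rightarrow> nat) \<Rightarrow> bool" where
  "exp_bounded f \<longleftrightarrow> (\<exists>c. \<forall>n. f n \<le> 2 ^ (c * n + c))"

lemma exp_bounded_mono: "\<lbrakk>exp_bounded g; \<And>n. f n \<le> g n\<rbrakk> \<Longrightarrow> exp_bounded f"
  unfolding exp_bounded_def by (meson le_trans)

lemma exp_bounded_power: "exp_bounded (\<lambda>n. K ^ n)"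
  unfolding exp_bounded_def
proof (intro exI allI)
  fix n
  have "K ^ n \<le> (2 ^ K) ^ n" by (rule power_mono) simp_all
  also have "\<dots> = 2 ^ (K * n)" by (simp add: power_mult)
  also have "\<dots> \<le> 2 ^ (K * n + K)" by (rule power_increasing) auto
  finally show "K ^ n \<le> 2 ^ (K * n + K)" .
qed

lemma exp_bounded_mult:
  assumes "exp_bounded f" "exp_bounded g"
  shows "exp_bounded (\<lambda>n. f n * g n)"
proof -
  obtain c d where "\<And>n. f n \<le> 2 ^ (c * n + c)" "\<And>n. g n \<le> 2 ^ (d * n + d)"
    using assms unfolding exp_bounded_def by blast
  then have "f n * g n \<le> 2 ^ (c * n + c) * 2 ^ (d * n + d)" for n by (rule mult_le_mono)
  also have "2 ^ (c * n + c) * 2 ^ (d * n + d) = (2::nat) ^ ((c + d) * n + (c + d))" for n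
    by (simp add: power_add[symmetric] algebra_simps)
  finally show ?thesis unfolding exp_bounded_def by blast
qed

lemma exp_bounded_const: "exp_bounded (\<lambda>n. c)"
  unfolding exp_bounded_def
proof (intro exI allI)
  fix n
  have "c \<le> 2 ^ c" by simp
  also have "\<dots> \<le> 2 ^ (c * n + c)" by (rule power_increasing) auto
  finally show "c \<le> 2 ^ (c * n + c)" .
qed

lemma exp_bounded_ident: "exp_bounded (\<lambda>n. n)"
  using exp_bounded_power[of 2] by (rule exp_bounded_mono) simp

lemma exp_bounded_add:
  assumes "exp_bounded f" "exp_bounded g"
  shows "exp_bounded (\<lambda>n. f n + g n)"
proof -
  obtain c d where bounds: "\<And>n. f n \<le> 2 ^ (c * n + c)" "\<And>n. g n \<le> 2 ^ (d * n + d)"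
    using assms unfolding exp_bounded_def by blast
  let ?b = "\<lambda>n. (c + d) * n + (c + d)"
  have "f n + g n \<le> 2 ^ (Suc (c + d) * n + Suc (c + d))" for n
  proof -
    have "(2::nat) ^ (c * n + c) \<le> 2 ^ ?b n" "(2::nat) ^ (d * n + d) \<le> 2 ^ ?b n"
      by (rule power_increasing; simp add: algebra_simps)+
    then have "f n + g n \<le> 2 * 2 ^ ?b n" using bounds[of n] by linarith
    also have "\<dots> = 2 ^ Suc (?b n)" by simp
    also have "\<dots> \<le> 2 ^ (Suc (c + d) * n + Suc (c + d))" by (rule power_increasing) auto
    finally show ?thesis .
  qed
  then show ?thesis unfolding exp_bounded_def by blast
qed

lemmas exp_bounded_intros =
  exp_bounded_const exp_bounded_ident exp_bounded_add exp_bounded_mult exp_bounded_power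

section \<open>Two concrete machines\<close>

definition word_tape :: "bool list \<Rightarrow> tape" where
  "word_tape w = ((\<lambda>i. if i < length w then Bit (w ! i) else Blank), length w)"

lemma word_tape_Nil: "word_tape [] = blank_tape"
  by (simp add: word_tape_def blank_tape_def)

lemma read_word_tape [simp]: "read (word_tape w) = Blank"
  by (simp add: word_tape_def)

lemma act_word_tape [simp]: "act (Bit b, Rgt) (word_tape w) = word_tape (w @ [b])"
  by (auto simp: word_tape_def nth_append fun_eq_iff less_Suc_eq)

lemma act_Stay [simp]: "s = read T \<Longrightarrow> act (s, Stay) T = T"
  by (cases T) simp

lemma tape_number_word_tape [simp]: "tape_number (word_tape w) = nat_of_bits w"
proof -
  have "(LEAST i. \<forall>b. fst (word_tape w) i \<noteq> Bit b) = length w"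
    by (rule Least_equality) (auto simp: word_tape_def split: if_splits intro: ccontr)
  moreover have "map (\<lambda>i. fst (word_tape w) i = Bit True) [0..<length w] = w"
    by (rule nth_equalityI) (auto simp: word_tape_def)
  ultimately show ?thesis by (simp add: tape_number_def)
qed

definition input_at :: "nat \<Rightarrow> nat \<Rightarrow> tape" where
  "input_at x h = (fst (input_tape x), h)"

lemma input_at_0: "input_tape x = input_at x 0"
  by (simp add: input_at_def input_tape_def)

lemma read_input_at [simp]:
  "read (input_at x h) = (if h < bit_length x then Bit (bits x ! h) else Blank)"
  by (simp add: input_at_def input_tape_def)

lemma act_input_at [simp]:
  "s = read (input_at x h) \<Longrightarrow> act (s, Rgt) (input_at x h) = input_at x (Suc h)"
  by (simp add: input_at_def)

definition symbols :: "nat \<Rightarrow> symb set" where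
  "symbols K = insert Blank (range Bit \<union> Aux ` {..K})"

lemma finite_symbols: "finite (symbols K)"
  by (simp add: symbols_def)

lemma symbols_simps [simp]: "Blank \<in> symbols K" "Bit b \<in> symbols K" "Aux d \<in> symbols K \<longleftrightarrow> d \<le> K"
  by (auto simp: symbols_def)

text \<open>The states \<open>0, \<dots>, k + 1\<close> are for writing a tag, \<open>k + 2\<close> and \<open>k + 3\<close> for the work proper.\<close>

definition query_machine ::
  "nat \<Rightarrow> nat \<Rightarrow> nat \<Rightarrow> (nat \<Rightarrow> symb list \<Rightarrow> (nat \<times> (symb \<times> dir) list) set) \<Rightarrow> machine" where
  "query_machine t K k prog = \<lparr>num_tapes = t,
     instrs = {(q, rs, q', as).
       q < k + 4 \<and> set rs \<subseteq> symbols K \<and> length rs = t \<and> (q', as) \<in> prog q rs},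
     start_state = 0, accept_state = k + 5, query_state = k + 4,
     yes_state = k + 5, no_state = k + 6\<rparr>"

lemma query_machine_simps [simp]:
  "num_tapes (query_machine t K k prog) = t"
  "start_state (query_machine t K k prog) = 0"
  "accept_state (query_machine t K k prog) = k + 5"
  "query_state (query_machine t K k prog) = k + 4"
  "yes_state (query_machine t K k prog) = k + 5"
  "no_state (query_machine t K k prog) = k + 6"
  "(q, rs, q', as) \<in> instrs (query_machine t K k prog) \<longleftrightarrow>
     q < k + 4 \<and> set rs \<subseteq> symbols K \<and> length rs = t \<and> (q', as) \<in> prog q rs"
  by (simp_all add: query_machine_def)

lemma oracle_machine_query_machine:
  assumes "2 \<le> t" "\<And>q rs. finite (prog q rs)"
    "\<And>q rs q' as. (q', as) \<in> prog q rs \<Longrightarrow> length as = t"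
  shows "oracle_machine (query_machine t K k prog)"
proof -
  let ?R = "{rs. set rs \<subseteq> symbols K \<and> length rs = t}"
  have "finite (SIGMA q:{..<k + 4}. SIGMA rs:?R. prog q rs)"
    using assms(2) finite_lists_length_eq[OF finite_symbols] by (intro finite_SigmaI) auto
  moreover have "instrs (query_machine t K k prog) = (SIGMA q:{..<k + 4}. SIGMA rs:?R. prog q rs)"
    by (auto simp: query_machine_def)
  ultimately show ?thesis using assms(1,3) by (auto simp: oracle_machine_def)
qed

lemma step_query_machine:
  assumes "q < k + 4" "length ts = t" "read ` set ts \<subseteq> symbols K"
  shows "step (query_machine t K k prog) A (q, ts) c \<longleftrightarrow>
    (\<exists>p\<in>prog q (map read ts). c = (fst p, map2 act (snd p) ts))"
proof
  assume "step (query_machine t K k prog) A (q, ts) c"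
  then show "\<exists>p\<in>prog q (map read ts). c = (fst p, map2 act (snd p) ts)"
    using assms(1) by cases (auto intro: bexI[rotated])
qed (use assms in \<open>auto intro!: step.instr\<close>)

lemma step_query_machine_query:
  "step (query_machine t K k prog) A (k + 4, ts) c \<longleftrightarrow>
    c = (if tape_number (ts ! 1) \<in> A then k + 5 else k + 6, ts)"
proof
  assume "step (query_machine t K k prog) A (k + 4, ts) c"
  then show "c = (if tape_number (ts ! 1) \<in> A then k + 5 else k + 6, ts)" by cases auto
next
  assume "c = (if tape_number (ts ! 1) \<in> A then k + 5 else k + 6, ts)"
  then show "step (query_machine t K k prog) A (k + 4, ts) c"
    using step.query[of "query_machine t K k prog" A ts] by (simp only: query_machine_simps)
qed

lemma halted_query_machine:
  assumes "k + 4 < q"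
  shows "halted (query_machine t K k prog) A (q, ts)"
  unfolding halted_def
proof
  assume "\<exists>c. step (query_machine t K k prog) A (q, ts) c"
  then obtain c where "step (query_machine t K k prog) A (q, ts) c" by blast
  then show False using assms by cases auto
qed

subsection \<open>Guessing a witness\<close>

definition guess_prog :: "nat \<Rightarrow> nat \<Rightarrow> symb list \<Rightarrow> (nat \<times> (symb \<times> dir) list) set" where
  "guess_prog k q rs =
    (if q \<le> k then {(q + 1, [(rs ! 0, Stay), (Bit True, Rgt)])}
     else if q = k + 1 then {(k + 2, [(rs ! 0, Stay), (Bit False, Rgt)])}
     else if q = k + 2 then
       (case rs ! 0 of Bit b \<Rightarrow> {(k + 3, [(rs ! 0, Stay), (Bit b, Rgt)])}
        | _ \<Rightarrow> {(k + 4, [(rs ! 0, Stay), (rs ! 1, Stay)])})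
     else range (\<lambda>g. (k + 2, [(rs ! 0, Rgt), (Bit g, Rgt)])))"

definition guess_machine :: "nat \<Rightarrow> machine" where
  "guess_machine k = query_machine 2 0 k (guess_prog k)"

lemma oracle_machine_guess_machine: "oracle_machine (guess_machine k)"
  unfolding guess_machine_def
  by (rule oracle_machine_query_machine) (auto simp: guess_prog_def split: symb.splits if_splits)

definition guess_config :: "nat \<Rightarrow> nat \<Rightarrow> nat \<Rightarrow> bool list \<Rightarrow> config" where
  "guess_config x q h w = (q, [input_at x h, word_tape w])"

lemma init_guess_machine: "init (guess_machine k) x = guess_config x 0 0 []"
  by (simp add: init_def guess_machine_def guess_config_def input_at_0 word_tape_Nil)

lemma step_guess_machine:
  assumes "q < k + 4"
  shows "step (guess_machine k) A (q, [input_at x h, word_tape w]) c \<longleftrightarrow>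
    (\<exists>p\<in>guess_prog k q [read (input_at x h), Blank].
       c = (fst p, map2 act (snd p) [input_at x h, word_tape w]))"
  unfolding guess_machine_def using assms by (subst step_query_machine) auto

lemma step_guess_tag:
  "i \<le> k \<Longrightarrow> step (guess_machine k) A (guess_config x i h w) c \<longleftrightarrow>
    c = guess_config x (Suc i) h (w @ [True])"
  by (auto simp: step_guess_machine guess_prog_def guess_config_def)

lemma step_guess_separator:
  "step (guess_machine k) A (guess_config x (k + 1) h w) c \<longleftrightarrow>
    c = guess_config x (k + 2) h (w @ [False])"
  by (auto simp: step_guess_machine guess_prog_def guess_config_def)

lemma step_guess_copy:
  "h < bit_length x \<Longrightarrow> step (guess_machine k) A (guess_config x (k + 2) h w) c \<longleftrightarrow>
    c = guess_config x (k + 3) h (w @ [bits x ! h])"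
  by (auto simp: step_guess_machine guess_prog_def guess_config_def)

lemma step_guess_guess:
  "h < bit_length x \<Longrightarrow> step (guess_machine k) A (guess_config x (k + 3) h w) c \<longleftrightarrow>
    (\<exists>g. c = guess_config x (k + 2) (Suc h) (w @ [g]))"
  by (auto simp: step_guess_machine guess_prog_def guess_config_def)

lemma step_guess_end:
  "step (guess_machine k) A (guess_config x (k + 2) (bit_length x) w) c \<longleftrightarrow>
    c = guess_config x (k + 4) (bit_length x) w"
  by (auto simp: step_guess_machine guess_prog_def guess_config_def)

lemma step_guess_query:
  "step (guess_machine k) A (guess_config x (k + 4) h w) c \<longleftrightarrow>
    c = guess_config x (if nat_of_bits w \<in> A then k + 5 else k + 6) h w"
  by (auto simp: guess_machine_def guess_config_def step_query_machine_query)

definition guess_word :: "nat \<Rightarrow> nat \<Rightarrow> bool list \<Rightarrow> bool list" where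
  "guess_word k x y = tag_word k @ splice (take (length y) (bits x)) y"

lemma guess_word_Nil: "guess_word k x [] = tag_word k"
  by (simp add: guess_word_def)

lemma guess_word_snoc:
  "length y < bit_length x \<Longrightarrow>
    guess_word k x (y @ [g]) = guess_word k x y @ [bits x ! length y, g]"
  by (simp add: guess_word_def take_Suc_conv_app_nth splice_snoc)

lemma nat_of_bits_guess_word:
  "length y = bit_length x \<Longrightarrow> nat_of_bits (guess_word k x y) = tagged k (splice (bits x) y)"
  by (simp add: guess_word_def tagged_def)

text \<open>The last argument bounds the number of remaining steps.\<close>

inductive guess_invariant :: "nat \<Rightarrow> nat set \<Rightarrow> nat \<Rightarrow> config \<Rightarrow> nat \<Rightarrow> bool" for k A x where
  tag: "i \<le> k + 1 \<Longrightarrow> guess_invariant k A x (guess_config x i 0 (replicate i True))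
     (2 * bit_length x + 2 + (k + 2 - i))"
| copy: "length y \<le> bit_length x \<Longrightarrow>
     guess_invariant k A x (guess_config x (k + 2) (length y) (guess_word k x y))
       (2 * (bit_length x - length y) + 2)"
| guess: "length y < bit_length x \<Longrightarrow>
     guess_invariant k A x
       (guess_config x (k + 3) (length y) (guess_word k x y @ [bits x ! length y]))
       (2 * (bit_length x - length y) + 1)"
| query: "length y = bit_length x \<Longrightarrow>
     guess_invariant k A x (guess_config x (k + 4) (length y) (guess_word k x y)) 1"
| accepted: "length y = bit_length x \<Longrightarrow> tagged k (splice (bits x) y) \<in> A \<Longrightarrow>
     guess_invariant k A x (k + 5, ts) 0"
| rejected: "guess_invariant k A x (k + 6, ts) 0"

lemma guess_invariant_init:
  "guess_invariant k A x (init (guess_machine k) x) (2 * bit_length x + k + 4)"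
  using guess_invariant.tag[of 0 k A x] by (simp add: init_guess_machine eval_nat_numeral)

lemma guess_invariant_step_tag:
  assumes "i \<le> k + 1" "step (guess_machine k) A (guess_config x i 0 (replicate i True)) c"
  shows "\<exists>r<2 * bit_length x + 2 + (k + 2 - i). guess_invariant k A x c r"
proof (cases "i \<le> k")
  case True
  then have "c = guess_config x (Suc i) 0 (replicate (Suc i) True)"
    using assms(2) by (simp add: step_guess_tag replicate_append_same)
  then have "guess_invariant k A x c (2 * bit_length x + 2 + (k + 2 - Suc i))"
    using guess_invariant.tag[of "Suc i" k A x] True by simp
  then show ?thesis using True by (intro exI conjI) auto
next
  case False
  then have last_tag: "i = k + 1" using assms(1) by simp
  have "c = guess_config x (k + 2) 0 (guess_word k x [])"
    using assms(2) unfolding last_tag step_guess_separator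
    by (simp add: guess_word_Nil tag_word_def)
  then show ?thesis using guess_invariant.copy[of "[]" x k A] last_tag by auto
qed

lemma guess_invariant_step_copy:
  assumes "length y \<le> bit_length x"
    and "step (guess_machine k) A (guess_config x (k + 2) (length y) (guess_word k x y)) c"
  shows "\<exists>r<2 * (bit_length x - length y) + 2. guess_invariant k A x c r"
proof (cases "length y < bit_length x")
  case True
  then have "guess_invariant k A x c (2 * (bit_length x - length y) + 1)"
    using assms(2) guess_invariant.guess[OF True, of k A] unfolding step_guess_copy[OF True] by simp
  then show ?thesis by (intro exI conjI) auto
next
  case False
  then have end_of_input: "length y = bit_length x" using assms(1) by simp
  then have "guess_invariant k A x c 1"
    using assms(2) guess_invariant.query[OF end_of_input, of k A]
    unfolding end_of_input step_guess_end by simp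
  then show ?thesis by (intro exI conjI) auto
qed

lemma guess_invariant_step:
  assumes "guess_invariant k A x c r" "step (guess_machine k) A c c'"
  shows "\<exists>r'<r. guess_invariant k A x c' r'"
proof -
  have running: "\<not> halted (guess_machine k) A c" using assms(2) unfolding halted_def by blast
  from assms(1) show ?thesis
  proof cases
    case (tag i)
    then show ?thesis using guess_invariant_step_tag assms(2) by blast
  next
    case (copy y)
    then show ?thesis using guess_invariant_step_copy assms(2) by blast
  next
    case (guess y)
    then obtain g
      where c': "c' = guess_config x (k + 2) (length (y @ [g])) (guess_word k x (y @ [g]))"
      using assms(2) by (auto simp: step_guess_guess guess_word_snoc)
    have "guess_invariant k A x c' (2 * (bit_length x - length (y @ [g])) + 2)"
      unfolding c' by (rule guess_invariant.copy) (use guess in simp)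
    then show ?thesis using guess by (intro exI conjI) auto
  next
    case (query y)
    then have "guess_invariant k A x c' 0"
      using assms(2) guess_invariant.accepted[of y x k A] guess_invariant.rejected
      unfolding query(1) step_guess_query by (auto simp: nat_of_bits_guess_word guess_config_def)
    then show ?thesis using query(2) by auto
  qed (use running in \<open>auto simp: guess_machine_def halted_query_machine\<close>)
qed

lemma guess_invariant_run:
  "(step (guess_machine k) A ^^ j) (init (guess_machine k) x) c \<Longrightarrow>
    \<exists>r. j + r \<le> 2 * bit_length x + k + 4 \<and> guess_invariant k A x c r"
proof (induction j arbitrary: c)
  case 0
  then show ?case using guess_invariant_init by auto
next
  case (Suc j)
  then obtain d where run: "(step (guess_machine k) A ^^ j) (init (guess_machine k) x) d"
    "step (guess_machine k) A d c" by auto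
  from Suc.IH[OF run(1)] obtain r
    where invariant: "j + r \<le> 2 * bit_length x + k + 4" "guess_invariant k A x d r" by blast
  from guess_invariant_step[OF invariant(2) run(2)] obtain r'
    where "r' < r" "guess_invariant k A x c r'" by blast
  then show ?case using invariant(1) by (intro exI[of _ r']) auto
qed

lemma guess_machine_poly_time: "\<exists>c. runs_in_time (guess_machine k) A (clock c)"
proof -
  have "poly_bounded (\<lambda>n. 2 * n + k + 4)" by (intro poly_bounded_intros)
  then obtain c where "\<And>n. 2 * n + k + 4 \<le> clock c n" using poly_bounded_imp_le_clock by blast
  moreover have "j \<le> 2 * bit_length x + k + 4"
    if "(step (guess_machine k) A ^^ j) (init (guess_machine k) x) c" for x j c
    using guess_invariant_run[OF that] by auto
  ultimately show ?thesis unfolding runs_in_time_def by (meson le_trans)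
qed

lemma guess_machine_reaches_word:
  assumes "length y \<le> bit_length x"
  shows "reaches (guess_machine k) A x (guess_config x (k + 2) (length y) (guess_word k x y))"
  using assms
proof (induction y rule: rev_induct)
  case Nil
  have "i \<le> k + 1 \<Longrightarrow> reaches (guess_machine k) A x (guess_config x i 0 (replicate i True))" for i
  proof (induction i)
    case (Suc i)
    then have "step (guess_machine k) A (guess_config x i 0 (replicate i True))
        (guess_config x (Suc i) 0 (replicate (Suc i) True))"
      by (simp add: step_guess_tag replicate_append_same)
    then show ?case using Suc unfolding reaches_def by (meson Suc_leD rtranclp.simps)
  qed (simp add: reaches_def init_guess_machine)
  moreover have "step (guess_machine k) A (guess_config x (k + 1) 0 (replicate (k + 1) True))
      (guess_config x (k + 2) 0 (tag_word k))"
    unfolding step_guess_separator by (simp add: tag_word_def)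
  ultimately show ?case
    unfolding reaches_def guess_word_Nil
    by (metis le_refl list.size(3) rtranclp.rtrancl_into_rtrancl)
next
  case (snoc g y)
  then have inside: "length y < bit_length x" by simp
  have "step (guess_machine k) A (guess_config x (k + 2) (length y) (guess_word k x y))
      (guess_config x (k + 3) (length y) (guess_word k x y @ [bits x ! length y]))"
    using step_guess_copy[OF inside] by blast
  moreover have "step (guess_machine k) A
      (guess_config x (k + 3) (length y) (guess_word k x y @ [bits x ! length y]))
      (guess_config x (k + 2) (length (y @ [g])) (guess_word k x (y @ [g])))"
    using step_guess_guess[OF inside] by (auto simp: guess_word_snoc[OF inside])
  ultimately show ?case using snoc.IH inside
    unfolding reaches_def by (meson less_imp_le rtranclp.rtrancl_into_rtrancl)
qed

lemma accepts_guess_machineI: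
  assumes y: "length y = bit_length x" "tagged k (splice (bits x) y) \<in> A"
  shows "accepts (guess_machine k) A x"
proof -
  let ?c = "\<lambda>q. guess_config x q (length y) (guess_word k x y)"
  have "step (guess_machine k) A (?c (k + 2)) (?c (k + 4))"
    unfolding y(1) step_guess_end ..
  moreover have "step (guess_machine k) A (?c (k + 4)) (?c (k + 5))"
    unfolding step_guess_query using y by (simp add: nat_of_bits_guess_word)
  ultimately have "reaches (guess_machine k) A x (?c (k + 5))"
    using guess_machine_reaches_word[OF eq_imp_le[OF y(1)], of k A]
    unfolding reaches_def by (meson rtranclp.rtrancl_into_rtrancl)
  moreover have "halted (guess_machine k) A (?c (k + 5))"
    unfolding guess_machine_def guess_config_def by (rule halted_query_machine) simp
  ultimately show ?thesis
    unfolding accepts_def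
    by (intro exI[of _ "?c (k + 5)"]) (simp add: guess_machine_def guess_config_def)
qed

lemma accepts_guess_machine_iff:
  "accepts (guess_machine k) A x \<longleftrightarrow>
    (\<exists>y. length y = bit_length x \<and> tagged k (splice (bits x) y) \<in> A)"
proof
  assume "accepts (guess_machine k) A x"
  then obtain j c where run: "(step (guess_machine k) A ^^ j) (init (guess_machine k) x) c"
    and "fst c = k + 5"
    unfolding accepts_def reaches_def by (auto simp: guess_machine_def dest!: rtranclp_imp_relpowp)
  from guess_invariant_run[OF run] obtain r where "guess_invariant k A x c r" by blast
  then show "\<exists>y. length y = bit_length x \<and> tagged k (splice (bits x) y) \<in> A"
    using \<open>fst c = k + 5\<close> by cases (auto simp: guess_config_def)
qed (auto intro: accepts_guess_machineI)

subsection \<open>Exponential padding\<close>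

text \<open>The work tape holds a left marker \<open>Aux (K + 1)\<close> followed by digits. A single rule (increment a
  digit and move right, or reset the full digit \<open>Aux K\<close> and move left; also move left at a blank)
  makes the head traverse the complete \<open>K\<close>-ary tree of depth the number of digits and
  then leave to the left. \<open>traversal K m\<close> is the duration for \<open>m\<close> digits. The head enters the tree
  from the right end, so the traversals for all numbers of digits up to \<open>n\<close> are performed one
  after the other. A bit is appended to the query tape in every step.\<close>

fun traversal :: "nat \<Rightarrow> nat \<Rightarrow> nat" where
  "traversal K 0 = 1"
| "traversal K (Suc m) = K * (1 + traversal K m) + 1"

definition padding :: "nat \<Rightarrow> nat \<Rightarrow> nat" where
  "padding K n = (\<Sum>i\<le>n. traversal K i)"

lemma padding_Suc: "padding K (Suc n) = padding K n + traversal K (Suc n)"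
  by (simp add: padding_def)

lemma strict_mono_padding: "strict_mono (padding K)"
proof -
  have "0 < traversal K m" for m by (cases m) auto
  then show ?thesis by (simp add: strict_mono_Suc_iff padding_def)
qed

lemma power_le_padding: "K ^ n \<le> padding K n"
proof -
  have "K ^ n \<le> traversal K n"
    by (induction n) (auto simp: algebra_simps intro!: le_SucI trans_le_add2)
  also have "\<dots> \<le> padding K n" unfolding padding_def by (rule member_le_sum) auto
  finally show ?thesis .
qed

lemma traversal_less: "traversal K m < (K + 2) ^ Suc m"
proof (induction m)
  case (Suc m)
  have "traversal K (Suc m) < K * (traversal K m + 1) + 2" by simp
  also have "\<dots> \<le> K * (K + 2) ^ Suc m + 2 * (K + 2) ^ Suc m"
    using Suc by (intro add_mono mult_le_mono) (auto simp del: power_Suc)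
  finally show ?case by (simp add: algebra_simps)
qed simp

lemma exp_bounded_padding: "exp_bounded (padding K)"
proof (rule exp_bounded_mono)
  show "exp_bounded (\<lambda>n. (n + 1) * ((K + 2) * (K + 2) ^ n))" by (intro exp_bounded_intros)
next
  fix n
  have "traversal K i \<le> (K + 2) ^ Suc n" if "i \<in> {..n}" for i
  proof -
    have "(K + 2) ^ Suc i \<le> (K + 2) ^ Suc n" using that by (intro power_increasing) auto
    then show ?thesis using traversal_less[of K i] by linarith
  qed
  then have "padding K n \<le> of_nat (card {..n}) * (K + 2) ^ Suc n"
    unfolding padding_def by (rule sum_bounded_above)
  then show "padding K n \<le> (n + 1) * ((K + 2) * (K + 2) ^ n)" by simp
qed

definition pad_prog :: "nat \<Rightarrow> nat \<Rightarrow> nat \<Rightarrow> symb list \<Rightarrow> nat \<times> (symb \<times> dir) list" where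
  "pad_prog K k q rs =
    (if q \<le> k then (q + 1, [(rs ! 0, Stay), (Bit True, Rgt), (rs ! 2, Stay)])
     else if q = k + 1 then (k + 2, [(rs ! 0, Stay), (Bit False, Rgt), (Aux (K + 1), Rgt)])
     else if q = k + 2 then
       (case rs ! 0 of Bit b \<Rightarrow> (k + 2, [(rs ! 0, Rgt), (Bit b, Rgt), (Aux 0, Rgt)])
        | _ \<Rightarrow> (k + 3, [(rs ! 0, Stay), (rs ! 1, Stay), (rs ! 2, Stay)]))
     else
       (case rs ! 2 of
          Aux d \<Rightarrow>
            (if d < K then (k + 3, [(rs ! 0, Stay), (Bit False, Rgt), (Aux (d + 1), Rgt)])
             else if d = K then (k + 3, [(rs ! 0, Stay), (Bit False, Rgt), (Aux 0, Lft)])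
             else (k + 4, [(rs ! 0, Stay), (rs ! 1, Stay), (rs ! 2, Stay)]))
        | _ \<Rightarrow> (k + 3, [(rs ! 0, Stay), (Bit False, Rgt), (rs ! 2, Lft)])))"

definition pad_machine :: "nat \<Rightarrow> nat \<Rightarrow> machine" where
  "pad_machine K k = query_machine 3 (K + 1) k (\<lambda>q rs. {pad_prog K k q rs})"

lemma oracle_machine_pad_machine: "oracle_machine (pad_machine K k)"
  unfolding pad_machine_def
  by (rule oracle_machine_query_machine) (auto simp: pad_prog_def split: symb.splits if_splits)

lemma deterministic_pad_machine: "deterministic (pad_machine K k)"
  unfolding pad_machine_def deterministic_def query_machine_simps singleton_iff
  by (metis prod.inject)

definition pad_config :: "nat \<Rightarrow> nat \<Rightarrow> nat \<Rightarrow> bool list \<Rightarrow> tape \<Rightarrow> config" where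
  "pad_config x q h w T = (q, [input_at x h, word_tape w, T])"

lemma init_pad_machine: "init (pad_machine K k) x = pad_config x 0 0 [] blank_tape"
  by (simp add: init_def pad_machine_def pad_config_def input_at_0 word_tape_Nil numeral_2_eq_2)

lemma step_pad_machine:
  assumes "q < k + 4" "read T \<in> symbols (K + 1)"
    and "pad_prog K k q [read (input_at x h), Blank, read T] = (q', as)"
  shows "step (pad_machine K k) A (pad_config x q h w T)
    (q', map2 act as [input_at x h, word_tape w, T])"
  unfolding pad_machine_def pad_config_def using assms by (subst step_query_machine) auto

lemma step_pad_tag:
  assumes "i \<le> k" "read T \<in> symbols (K + 1)"
  shows "step (pad_machine K k) A (pad_config x i h w T) (pad_config x (Suc i) h (w @ [True]) T)"
  using step_pad_machine[of i k T K x h] assms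
  by (simp add: pad_prog_def pad_config_def)

lemma step_pad_separator:
  assumes "read T \<in> symbols (K + 1)"
  shows "step (pad_machine K k) A (pad_config x (k + 1) h w T)
    (pad_config x (k + 2) h (w @ [False]) (act (Aux (K + 1), Rgt) T))"
  using step_pad_machine[of "k + 1" k T K x h] assms
  by (simp add: pad_prog_def pad_config_def)

lemma step_pad_copy:
  assumes "h < bit_length x" "read T \<in> symbols (K + 1)"
  shows "step (pad_machine K k) A (pad_config x (k + 2) h w T)
    (pad_config x (k + 2) (Suc h) (w @ [bits x ! h]) (act (Aux 0, Rgt) T))"
  using step_pad_machine[of "k + 2" k T K x h] assms
  by (simp add: pad_prog_def pad_config_def)

lemma step_pad_end:
  assumes "read T \<in> symbols (K + 1)"
  shows "step (pad_machine K k) A (pad_config x (k + 2) (bit_length x) w T)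
    (pad_config x (k + 3) (bit_length x) w T)"
  using step_pad_machine[of "k + 2" k T K x "bit_length x"] assms
  by (simp add: pad_prog_def pad_config_def)

lemma step_pad_increment:
  assumes "g p = Aux d" "d < K"
  shows "step (pad_machine K k) A (pad_config x (k + 3) h w (g, p))
    (pad_config x (k + 3) h (w @ [False]) (g(p := Aux (Suc d)), Suc p))"
  using step_pad_machine[of "k + 3" k "(g, p)" K x h] assms
  by (simp add: pad_prog_def pad_config_def)

lemma step_pad_reset:
  assumes "g p = Aux K"
  shows "step (pad_machine K k) A (pad_config x (k + 3) h w (g, p))
    (pad_config x (k + 3) h (w @ [False]) (g(p := Aux 0), p - 1))"
  using step_pad_machine[of "k + 3" k "(g, p)" K x h] assms
  by (simp add: pad_prog_def pad_config_def)

lemma step_pad_blank: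
  assumes "g p = Blank"
  shows "step (pad_machine K k) A (pad_config x (k + 3) h w (g, p))
    (pad_config x (k + 3) h (w @ [False]) (g, p - 1))"
  using step_pad_machine[of "k + 3" k "(g, p)" K x h] assms
  by (simp add: pad_prog_def pad_config_def fun_upd_idem)

lemma step_pad_marker:
  assumes "g p = Aux (K + 1)"
  shows "step (pad_machine K k) A (pad_config x (k + 3) h w (g, p))
    (pad_config x (k + 4) h w (g, p))"
  using step_pad_machine[of "k + 3" k "(g, p)" K x h] assms
  by (simp add: pad_prog_def pad_config_def fun_upd_idem)

lemma step_pad_query:
  "step (pad_machine K k) A (pad_config x (k + 4) h w T)
    (pad_config x (if nat_of_bits w \<in> A then k + 5 else k + 6) h w T)"
  by (simp add: pad_machine_def pad_config_def step_query_machine_query)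

lemma pad_digit_run:
  assumes subtree: "\<And>w g'. (\<And>i. i \<noteq> p \<Longrightarrow> g' i = g i) \<Longrightarrow>
      (step (pad_machine K k) A ^^ t) (pad_config x (k + 3) h w (g', Suc p))
        (pad_config x (k + 3) h (w @ replicate t False) (g', p))"
    and "g p = Aux 0"
  shows "j \<le> K \<Longrightarrow> (step (pad_machine K k) A ^^ (j * (1 + t) + 1))
    (pad_config x (k + 3) h w (g(p := Aux (K - j)), p))
    (pad_config x (k + 3) h (w @ replicate (j * (1 + t) + 1) False) (g, p - 1))"
proof (induction j arbitrary: w)
  case 0
  have "(g(p := Aux K))(p := Aux 0) = g" using assms(2) by (simp add: fun_upd_idem)
  then have "(step (pad_machine K k) A ^^ 1) (pad_config x (k + 3) h w (g(p := Aux K), p))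
      (pad_config x (k + 3) h (w @ replicate 1 False) (g, p - 1))"
    using step_pad_reset[of "g(p := Aux K)" p K k A x h w] unfolding relpowp_1 by simp
  then show ?case by (simp only: mult_0 add_0 diff_zero)
next
  case (Suc j)
  let ?g = "g(p := Aux (K - j))"
  have "step (pad_machine K k) A (pad_config x (k + 3) h w (g(p := Aux (K - Suc j)), p))
      (pad_config x (k + 3) h (w @ [False]) (?g, Suc p))"
    using step_pad_increment[of "g(p := Aux (K - Suc j))" p "K - Suc j" K k A x h w] Suc.prems
    by (simp add: Suc_diff_Suc)
  also have "(step (pad_machine K k) A ^^ t) \<dots>
      (pad_config x (k + 3) h ((w @ [False]) @ replicate t False) (?g, p))"
    by (rule subtree) simp
  also have "(step (pad_machine K k) A ^^ (j * (1 + t) + 1)) \<dots> (pad_config x (k + 3) h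
      (((w @ [False]) @ replicate t False) @ replicate (j * (1 + t) + 1) False) (g, p - 1))"
    by (rule Suc.IH) (use Suc.prems in simp)
  also have "((w @ [False]) @ replicate t False) @ replicate (j * (1 + t) + 1) False =
      w @ replicate (Suc j * (1 + t) + 1) False"
    by (simp flip: replicate_add add: replicate_app_Cons_same)
  also have "Suc t + (j * (1 + t) + 1) = Suc j * (1 + t) + 1" by simp
  finally show ?case .
qed

lemma pad_traversal:
  assumes "\<And>i. p \<le> i \<Longrightarrow> i < p + m \<Longrightarrow> g i = Aux 0" "g (p + m) = Blank"
  shows "(step (pad_machine K k) A ^^ traversal K m) (pad_config x (k + 3) h w (g, p))
    (pad_config x (k + 3) h (w @ replicate (traversal K m) False) (g, p - 1))"
  using assms
proof (induction m arbitrary: p g w)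
  case 0
  then show ?case using step_pad_blank[of g p K k A x h w]
    unfolding traversal.simps relpowp_1 by simp
next
  case (Suc m)
  have digit: "g p = Aux 0" using Suc.prems(1)[of p] by simp
  have subtree: "(step (pad_machine K k) A ^^ traversal K m) (pad_config x (k + 3) h w' (g', Suc p))
      (pad_config x (k + 3) h (w' @ replicate (traversal K m) False) (g', p))"
    if "\<And>i. i \<noteq> p \<Longrightarrow> g' i = g i" for g' w'
    using Suc.IH[of "Suc p" g' w'] Suc.prems that by simp
  have "(step (pad_machine K k) A ^^ (K * (1 + traversal K m) + 1))
      (pad_config x (k + 3) h w (g(p := Aux (K - K)), p))
      (pad_config x (k + 3) h (w @ replicate (K * (1 + traversal K m) + 1) False) (g, p - 1))"
    by (rule pad_digit_run[where g = g, OF subtree digit]) simp_all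
  then show ?case using digit by (simp add: fun_upd_idem)
qed

definition digits_tape :: "nat \<Rightarrow> nat \<Rightarrow> nat \<Rightarrow> symb" where
  "digits_tape K n i = (if i = 0 then Aux (K + 1) else if i \<le> n then Aux 0 else Blank)"

lemma pad_traversals:
  "m \<le> n \<Longrightarrow> (step (pad_machine K k) A ^^ padding K m)
    (pad_config x (k + 3) h w (digits_tape K n, Suc n))
    (pad_config x (k + 3) h (w @ replicate (padding K m) False) (digits_tape K n, n - m))"
proof (induction m)
  case 0
  then show ?case using pad_traversal[of "Suc n" 0 "digits_tape K n" K k A x h w]
    by (simp add: padding_def digits_tape_def[of K n "Suc n"] del: relpowp.simps)
next
  case (Suc m)
  then have "(step (pad_machine K k) A ^^ padding K m)
      (pad_config x (k + 3) h w (digits_tape K n, Suc n))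
      (pad_config x (k + 3) h (w @ replicate (padding K m) False) (digits_tape K n, n - m))"
    by simp
  also have "(step (pad_machine K k) A ^^ traversal K (Suc m)) \<dots> (pad_config x (k + 3) h
      ((w @ replicate (padding K m) False) @ replicate (traversal K (Suc m)) False)
      (digits_tape K n, n - m - 1))"
    by (rule pad_traversal) (use Suc.prems in \<open>auto simp: digits_tape_def\<close>)
  finally show ?case unfolding padding_Suc replicate_add by (simp del: traversal.simps)
qed

lemma pad_tag_run:
  "i \<le> k + 1 \<Longrightarrow> (step (pad_machine K k) A ^^ i) (init (pad_machine K k) x)
    (pad_config x i 0 (replicate i True) blank_tape)"
proof (induction i)
  case (Suc i)
  then have "(step (pad_machine K k) A ^^ i) (init (pad_machine K k) x)
    (pad_config x i 0 (replicate i True) blank_tape)" by simp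
  also have "step (pad_machine K k) A \<dots>
      (pad_config x (Suc i) 0 (replicate i True @ [True]) blank_tape)"
    using Suc.prems by (intro step_pad_tag) (auto simp: blank_tape_def)
  finally show ?case by (simp add: replicate_append_same)
qed (simp add: init_pad_machine)

lemma pad_copy_run:
  "h \<le> bit_length x \<Longrightarrow> (step (pad_machine K k) A ^^ (k + 2 + h)) (init (pad_machine K k) x)
    (pad_config x (k + 2) h (tag_word k @ take h (bits x)) (digits_tape K h, Suc h))"
proof (induction h)
  case 0
  have "(step (pad_machine K k) A ^^ (k + 1)) (init (pad_machine K k) x)
      (pad_config x (k + 1) 0 (replicate (k + 1) True) blank_tape)"
    by (rule pad_tag_run) simp
  also have "step (pad_machine K k) A \<dots> (pad_config x (k + 2) 0 (replicate (k + 1) True @ [False])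
      (act (Aux (K + 1), Rgt) blank_tape))"
    by (rule step_pad_separator) (simp add: blank_tape_def)
  also have "act (Aux (K + 1), Rgt) blank_tape = (digits_tape K 0, Suc 0)"
    by (auto simp: blank_tape_def digits_tape_def)
  finally show ?case by (simp add: tag_word_def)
next
  case (Suc h)
  then have "(step (pad_machine K k) A ^^ (k + 2 + h)) (init (pad_machine K k) x)
      (pad_config x (k + 2) h (tag_word k @ take h (bits x)) (digits_tape K h, Suc h))"
    by simp
  also have "step (pad_machine K k) A \<dots> (pad_config x (k + 2) (Suc h)
      ((tag_word k @ take h (bits x)) @ [bits x ! h]) (act (Aux 0, Rgt) (digits_tape K h, Suc h)))"
    using Suc.prems by (intro step_pad_copy) (auto simp: digits_tape_def)
  also have "act (Aux 0, Rgt) (digits_tape K h, Suc h) = (digits_tape K (Suc h), Suc (Suc h))"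
    by (auto simp: digits_tape_def)
  finally show ?case using Suc.prems by (simp add: take_Suc_conv_app_nth)
qed

definition padded :: "nat \<Rightarrow> nat \<Rightarrow> nat \<Rightarrow> nat" where
  "padded K k x = tagged k (bits x @ replicate (padding K (bit_length x)) False)"

lemma pad_machine_run:
  fixes K k x A
  defines "n \<equiv> bit_length x"
  obtains ts where
    "(step (pad_machine K k) A ^^ (k + n + padding K n + 5)) (init (pad_machine K k) x)
      (if padded K k x \<in> A then k + 5 else k + 6, ts)"
proof -
  let ?w = "tag_word k @ bits x" and ?D = "digits_tape K n"
  let ?w' = "?w @ replicate (padding K n) False"
  have "(step (pad_machine K k) A ^^ (k + 2 + n)) (init (pad_machine K k) x)
      (pad_config x (k + 2) n ?w (?D, Suc n))"
    using pad_copy_run[of n x k K A] by (simp add: n_def)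
  also have "step (pad_machine K k) A \<dots> (pad_config x (k + 3) n ?w (?D, Suc n))"
    unfolding n_def by (rule step_pad_end) (simp add: digits_tape_def)
  also have "(step (pad_machine K k) A ^^ padding K n) \<dots> (pad_config x (k + 3) n ?w' (?D, 0))"
    using pad_traversals[of n n K k A x n ?w] by simp
  also have "step (pad_machine K k) A \<dots> (pad_config x (k + 4) n ?w' (?D, 0))"
    by (rule step_pad_marker) (simp add: digits_tape_def)
  also have "step (pad_machine K k) A \<dots>
      (pad_config x (if nat_of_bits ?w' \<in> A then k + 5 else k + 6) n ?w' (?D, 0))"
    by (rule step_pad_query)
  also have "nat_of_bits ?w' = padded K k x" by (simp add: padded_def tagged_def n_def)
  also have "Suc (Suc (Suc (k + 2 + n) + padding K n)) = k + n + padding K n + 5" by simp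
  finally show thesis unfolding pad_config_def by (rule that)
qed

lemma halted_pad_machine:
  "halted (pad_machine K k) A (if b then k + 5 else k + 6, ts)"
  unfolding pad_machine_def by (rule halted_query_machine) auto

lemma accepts_pad_machine_iff: "accepts (pad_machine K k) A x \<longleftrightarrow> padded K k x \<in> A"
proof -
  let ?q = "if padded K k x \<in> A then k + 5 else k + 6"
  obtain ts where run: "reaches (pad_machine K k) A x (?q, ts)"
    using pad_machine_run[of k x K A] unfolding reaches_def by (meson relpowp_imp_rtranclp)
  have halt: "halted (pad_machine K k) A (?q, ts)" by (rule halted_pad_machine)
  have unique: "c = (?q, ts)"
    if "reaches (pad_machine K k) A x c" "halted (pad_machine K k) A c" for c
    using right_unique_terminal_unique[OF right_unique_step[OF deterministic_pad_machine]
        that(1)[unfolded reaches_def] that(2)[unfolded halted_def]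
        run[unfolded reaches_def] halt[unfolded halted_def]] .
  have accept: "accept_state (pad_machine K k) = k + 5" by (simp add: pad_machine_def)
  show ?thesis
  proof
    assume "accepts (pad_machine K k) A x"
    then obtain c
      where "reaches (pad_machine K k) A x c" "halted (pad_machine K k) A c" "fst c = k + 5"
      unfolding accepts_def accept by blast
    then have "?q = k + 5" using unique[of c] by simp
    then show "padded K k x \<in> A" by (simp split: if_splits)
  next
    assume "padded K k x \<in> A"
    then show "accepts (pad_machine K k) A x"
      using run halt unfolding accepts_def accept by (intro exI[of _ "(?q, ts)"]) simp
  qed
qed

lemma pad_machine_exp_time: "\<exists>c. runs_in_time (pad_machine K k) A (\<lambda>n. 2 ^ (c * n + c))"
proof -
  have "exp_bounded (\<lambda>n. k + n + padding K n + 5)"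
    by (intro exp_bounded_intros exp_bounded_padding)
  then obtain c where bound: "\<And>n. k + n + padding K n + 5 \<le> 2 ^ (c * n + c)"
    unfolding exp_bounded_def by blast
  have "j \<le> k + bit_length x + padding K (bit_length x) + 5"
    if run: "(step (pad_machine K k) A ^^ j) (init (pad_machine K k) x) d" for j x d
  proof -
    obtain ts where
      "(step (pad_machine K k) A ^^ (k + bit_length x + padding K (bit_length x) + 5))
        (init (pad_machine K k) x) (if padded K k x \<in> A then k + 5 else k + 6, ts)"
      by (rule pad_machine_run)
    from right_unique_relpowp_terminal[OF right_unique_step this _ run] deterministic_pad_machine
    show ?thesis using halted_pad_machine[of K k A] unfolding halted_def by blast
  qed
  then show ?thesis using bound unfolding runs_in_time_def by (meson le_trans)
qed

section \<open>The oracle\<close>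

instance symb :: countable
  by countable_datatype

instance dir :: countable
  by countable_datatype

lemma countable_oracle_machines: "countable {M. oracle_machine M}"
proof -
  let ?f = "\<lambda>M :: machine. (num_tapes M, instrs M, start_state M, accept_state M, query_state M,
    yes_state M, no_state M)"
  have "inj ?f" by (auto simp: inj_def)
  moreover have "?f ` {M. oracle_machine M} \<subseteq> UNIV \<times> {I. finite I} \<times> UNIV"
    by (auto simp: oracle_machine_def)
  moreover have "countable ((UNIV :: nat set) \<times> {I :: instr set. finite I} \<times>
      (UNIV :: (nat \<times> nat \<times> nat \<times> nat \<times> nat) set))"
    by (intro countable_SIGMA countable_Collect_finite) auto
  ultimately show ?thesis
    by (meson countable_image_inj_on countable_subset inj_on_subset subset_UNIV)
qed

definition nth_machine :: "nat \<Rightarrow> machine" where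
  "nth_machine = from_nat_into {M. oracle_machine M}"

lemma oracle_machine_nth_machine: "oracle_machine (nth_machine e)"
  unfolding nth_machine_def using from_nat_into[of "{M. oracle_machine M}" e]
    oracle_machine_guess_machine[of 0] by blast

lemma nth_machine_surj:
  assumes "oracle_machine M"
  obtains e where "nth_machine e = M"
  using from_nat_into_surj[OF countable_oracle_machines] assms unfolding nth_machine_def by blast

lemma bit_length_padded:
  "bit_length (padded K k x) = k + 2 + bit_length x + padding K (bit_length x)"
  by (simp add: padded_def bit_length_tagged)

lemma padded_inject: "padded K k x = padded K k x' \<longleftrightarrow> x = x'"
proof
  let ?n = "bit_length x" and ?n' = "bit_length x'"
  assume eq: "padded K k x = padded K k x'"
  have "strict_mono (\<lambda>n. n + padding K n)"
    using strict_mono_padding[of K] by (auto simp: strict_mono_def add_strict_mono)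
  moreover have "?n + padding K ?n = ?n' + padding K ?n'"
    using arg_cong[OF eq, of "\<lambda>q. bit_length q"] by (simp add: bit_length_padded)
  ultimately have "?n = ?n'" using strict_mono_eq[of "\<lambda>n. n + padding K n" ?n ?n'] by blast
  then show "x = x'" using eq by (simp add: padded_def)
qed simp

definition coding :: "nat \<Rightarrow> nat \<Rightarrow> nat \<Rightarrow> nat" where
  "coding e r x = padded (r + 2) (2 * prod_encode (e, r) + 1) x"

definition coding_numbers :: "nat set" where
  "coding_numbers = {coding e r x | e r x. True}"

lemma coding_inject: "coding e r x = coding e' r' x' \<longleftrightarrow> e = e' \<and> r = r' \<and> x = x'"
proof
  assume eq: "coding e r x = coding e' r' x'"
  then have "e = e'" "r = r'" by (auto simp: coding_def padded_def)
  then show "e = e' \<and> r = r' \<and> x = x'" using eq by (simp add: coding_def padded_inject)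
qed simp

lemma less_bit_length_coding: "x < bit_length (coding e r x)"
proof -
  have "x < 2 ^ bit_length x" using bit_length_le_iff by blast
  also have "\<dots> \<le> (r + 2) ^ bit_length x" by (rule power_mono) auto
  also have "\<dots> \<le> padding (r + 2) (bit_length x)" by (rule power_le_padding)
  finally show ?thesis by (simp add: coding_def bit_length_padded)
qed

lemma card_coding_numbers_le: "card (coding_numbers \<inter> {..<2 ^ L}) \<le> L * L"
proof -
  let ?f = "\<lambda>(i, x). coding (fst (prod_decode i)) (snd (prod_decode i)) x"
  have "coding_numbers \<inter> {..<2 ^ L} \<subseteq> ?f ` ({..<L} \<times> {..<L})"
  proof
    fix q assume "q \<in> coding_numbers \<inter> {..<2 ^ L}"
    then obtain e r x where coded: "q = coding e r x" "q < 2 ^ L"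
      unfolding coding_numbers_def by auto
    then have len: "bit_length (coding e r x) \<le> L" by (simp add: bit_length_le_iff)
    then have "prod_encode (e, r) < L" by (simp add: coding_def bit_length_padded)
    moreover have "x < L" using less_bit_length_coding len by (rule less_le_trans)
    ultimately show "q \<in> ?f ` ({..<L} \<times> {..<L})"
      using coded(1) by (intro image_eqI[of _ _ "(prod_encode (e, r), x)"]) auto
  qed
  then have "card (coding_numbers \<inter> {..<2 ^ L}) \<le> card (?f ` ({..<L} \<times> {..<L}))"
    by (intro card_mono) auto
  also have "\<dots> \<le> L * L"
    using card_image_le[of "{..<L} \<times> {..<L}" ?f] by simp
  finally show ?thesis .
qed

text \<open>A run whose length is below that of the query cannot ask the query itself.\<close>

definition budget :: "nat \<Rightarrow> nat" where
  "budget q = bit_length q - 1"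

lemma two_power_budget_le: "2 ^ budget (coding e r x) \<le> coding e r x"
  unfolding less_bit_length_iff[symmetric] by (simp add: budget_def coding_def bit_length_padded)

lemma budget_coding_ge: "2 ^ (c * bit_length x + c) \<le> budget (coding e (2 ^ (2 * c)) x)"
proof -
  define n where "n = bit_length x"
  define r :: nat where "r = 2 ^ (2 * c)"
  have budget: "r \<le> budget (coding e r x)" "padding (r + 2) n \<le> budget (coding e r x)"
    using le_prod_encode_2[of r e] by (auto simp: budget_def coding_def bit_length_padded n_def)
  have "2 ^ (c * n + c) \<le> budget (coding e r x)"
  proof (cases "n = 0")
    case True
    have "(2::nat) ^ c \<le> r" unfolding r_def by (intro power_increasing) auto
    then show ?thesis using True budget(1) by simp
  next
    case False
    then have "c * 1 \<le> c * n" by (intro mult_le_mono2) (simp add: Suc_le_eq)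
    then have "(2::nat) ^ (c * n + c) \<le> 2 ^ (2 * c * n)" by (intro power_increasing) auto
    also have "\<dots> = r ^ n" by (simp only: r_def power_mult)
    also have "\<dots> \<le> (r + 2) ^ n" by (rule power_mono) auto
    also have "\<dots> \<le> padding (r + 2) n" by (rule power_le_padding)
    finally show ?thesis using budget(2) by simp
  qed
  then show ?thesis by (simp add: n_def r_def)
qed

definition oracle_rule :: "nat set \<Rightarrow> nat set \<Rightarrow> nat \<Rightarrow> bool" where
  "oracle_rule W A q \<longleftrightarrow>
     (if q \<in> coding_numbers
      then \<exists>e r x. q = coding e r x \<and> accepts_within (nth_machine e) A x (budget q)
      else q \<in> W)"

primrec oracle_below :: "nat set \<Rightarrow> nat \<Rightarrow> nat set" where
  "oracle_below W 0 = {}"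
| "oracle_below W (Suc q) = oracle_below W q \<union> {u. u = q \<and> oracle_rule W (oracle_below W q) q}"

definition oracle_of :: "nat set \<Rightarrow> nat set" where
  "oracle_of W = {q. oracle_rule W (oracle_below W q) q}"

lemma oracle_below_eq: "oracle_below W q = oracle_of W \<inter> {..<q}"
proof (induction q)
  case (Suc q)
  have "{u. u = q \<and> oracle_rule W (oracle_below W q) q} = oracle_of W \<inter> {q}"
    by (auto simp: oracle_of_def)
  then have "oracle_below W (Suc q) = oracle_below W q \<union> oracle_of W \<inter> {q}"
    by (simp only: oracle_below.simps)
  also have "\<dots> = oracle_of W \<inter> {..<Suc q}" unfolding Suc.IH by (auto simp: less_Suc_eq)
  finally show ?case .
qed simp

lemma noncoding_mem_oracle_of: "u \<notin> coding_numbers \<Longrightarrow> u \<in> oracle_of W \<longleftrightarrow> u \<in> W"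
  by (simp add: oracle_of_def oracle_rule_def)

lemma coding_mem_oracle_of:
  "coding e r x \<in> oracle_of W \<longleftrightarrow>
    accepts_within (nth_machine e) (oracle_of W) x (budget (coding e r x))"
proof -
  have "coding e r x \<in> coding_numbers" by (auto simp: coding_numbers_def)
  then have "coding e r x \<in> oracle_of W \<longleftrightarrow>
      accepts_within (nth_machine e) (oracle_below W (coding e r x)) x (budget (coding e r x))"
    by (auto simp: oracle_of_def oracle_rule_def coding_inject)
  also have "\<dots> \<longleftrightarrow> accepts_within (nth_machine e) (oracle_of W) x (budget (coding e r x))"
    using two_power_budget_le[of e r x]
    by (intro accepts_within_cong oracle_machine_nth_machine)
      (auto simp: agree_on_def oracle_below_eq)
  finally show ?thesis .
qed

lemma agree_on_oracle_of:
  assumes "agree_on (Q \<inter> coding_numbers) (oracle_of W) (oracle_of W')"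
    and "agree_on (Q - coding_numbers) W W'"
  shows "agree_on Q (oracle_of W) (oracle_of W')"
  using assms unfolding agree_on_def by (metis DiffI IntI noncoding_mem_oracle_of)

lemma agree_on_lessThan_oracle_of:
  assumes "agree_on {..<B} W W'"
  shows "agree_on {..<B} (oracle_of W) (oracle_of W')"
proof -
  have "q \<le> B \<Longrightarrow> oracle_below W q = oracle_below W' q" for q
    using assms by (induction q) (auto simp: agree_on_def oracle_rule_def)
  then have "oracle_of W \<inter> {..<B} = oracle_of W' \<inter> {..<B}" by (metis oracle_below_eq order_refl)
  then show ?thesis by (auto simp: agree_on_def)
qed

lemma E_subset_NE: "E A \<subseteq> NE A"
  unfolding E_def NE_def DTIME_def NTIME_def by blast

lemma NE_subset_E_oracle_of: "NE (oracle_of W) \<subseteq> E (oracle_of W)"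
proof
  fix L assume "L \<in> NE (oracle_of W)"
  then obtain c M where language: "L = {x. accepts M (oracle_of W) x}"
    and machine: "oracle_machine M"
    and time: "runs_in_time M (oracle_of W) (\<lambda>n. 2 ^ (c * n + c))"
    unfolding NE_def NTIME_def by blast
  obtain e where index: "nth_machine e = M" using nth_machine_surj[OF machine] .
  define r :: nat where "r = 2 ^ (2 * c)"
  let ?D = "pad_machine (r + 2) (2 * prod_encode (e, r) + 1)"
  have "x \<in> L \<longleftrightarrow> accepts ?D (oracle_of W) x" for x
  proof -
    have "x \<in> L \<longleftrightarrow> accepts_within (nth_machine e) (oracle_of W) x (budget (coding e r x))"
      using accepts_within_iff[OF time] budget_coding_ge[of c x e]
      by (simp add: language index r_def)
    also have "\<dots> \<longleftrightarrow> coding e r x \<in> oracle_of W" by (simp add: coding_mem_oracle_of)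
    finally show ?thesis by (simp add: accepts_pad_machine_iff coding_def)
  qed
  then have "L = {x. accepts ?D (oracle_of W) x}" by blast
  moreover obtain c' where "runs_in_time ?D (oracle_of W) (\<lambda>n. 2 ^ (c' * n + c'))"
    using pad_machine_exp_time by blast
  ultimately show "L \<in> E (oracle_of W)"
    unfolding E_def DTIME_def using oracle_machine_pad_machine deterministic_pad_machine by blast
qed

section \<open>Freezing the coding numbers\<close>

definition freezes :: "nat set set \<Rightarrow> nat set \<Rightarrow> nat set \<Rightarrow> nat set \<Rightarrow> bool" where
  "freezes \<W> D W X \<longleftrightarrow> (\<forall>W'\<in>\<W>. agree_on D W W' \<longrightarrow> agree_on X (oracle_of W) (oracle_of W'))"

lemma coding_number_certificate:
  assumes "N \<in> coding_numbers" "N \<in> oracle_of W" "N < 2 ^ L"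
  obtains Q where "finite Q" "card Q \<le> L" "Q \<subseteq> {..<N}"
    "\<And>W'. agree_on Q (oracle_of W) (oracle_of W') \<Longrightarrow> N \<in> oracle_of W'"
proof -
  obtain e r x where coded: "N = coding e r x" using assms(1) unfolding coding_numbers_def by blast
  have "accepts_within (nth_machine e) (oracle_of W) x (budget N)"
    using assms(2) by (simp add: coded coding_mem_oracle_of)
  then obtain Q where "small_certificate (budget N) Q (oracle_of W)
      (\<lambda>V. accepts_within (nth_machine e) V x (budget N))"
    using exists_accepts_within_certificate oracle_machine_nth_machine by blast
  then have queries: "finite Q" "card Q \<le> budget N" "Q \<subseteq> {..<2 ^ budget N}"
    and cert: "certifies Q (oracle_of W) (\<lambda>V. accepts_within (nth_machine e) V x (budget N))"
    unfolding small_certificate_def by auto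
  have "bit_length N \<le> L" using assms(3) by (simp add: bit_length_le_iff)
  then have "card Q \<le> L" using queries(2) by (simp add: budget_def)
  moreover have "Q \<subseteq> {..<N}" using queries(3) two_power_budget_le[of e r x] coded by auto
  moreover have "N \<in> oracle_of W'" if "agree_on Q (oracle_of W) (oracle_of W')" for W'
    using certifiesD[OF cert that] by (simp add: coded coding_mem_oracle_of)
  ultimately show thesis using that queries(1) by blast
qed

lemma freezes_Suc_true:
  assumes frozen: "freezes \<W> D W (coding_numbers \<inter> {..<N})"
    and true_at: "W1 \<in> \<W>" "agree_on D W W1" "N \<in> oracle_of W1"
    and queries: "Q \<subseteq> {..<N}" "\<And>W'. agree_on Q (oracle_of W1) (oracle_of W') \<Longrightarrow> N \<in> oracle_of W'"
  shows "freezes \<W> (D \<union> Q) W1 (coding_numbers \<inter> {..<Suc N})"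
  unfolding freezes_def
proof (intro ballI impI)
  fix W' assume W': "W' \<in> \<W>" "agree_on (D \<union> Q) W1 W'"
  then have "agree_on D W W'" using true_at(2) agree_on_trans by auto
  then have below: "agree_on (coding_numbers \<inter> {..<N}) (oracle_of W1) (oracle_of W')"
    using frozen true_at(1,2) W'(1) unfolding freezes_def by (meson agree_on_sym agree_on_trans)
  have "agree_on Q (oracle_of W1) (oracle_of W')"
  proof (rule agree_on_oracle_of)
    show "agree_on (Q \<inter> coding_numbers) (oracle_of W1) (oracle_of W')"
      using below queries(1) by (auto intro: agree_on_subset)
    show "agree_on (Q - coding_numbers) W1 W'" using W'(2) by (auto intro: agree_on_subset)
  qed
  then have "N \<in> oracle_of W'" by (rule queries(2))
  then show "agree_on (coding_numbers \<inter> {..<Suc N}) (oracle_of W1) (oracle_of W')"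
    using below true_at(3) by (auto simp: agree_on_def less_Suc_eq)
qed

lemma freezes_Suc_false:
  assumes "freezes \<W> D W (coding_numbers \<inter> {..<N})" "W \<in> \<W>"
    and "\<And>W'. \<lbrakk>N \<in> coding_numbers; W' \<in> \<W>; agree_on D W W'\<rbrakk> \<Longrightarrow> N \<notin> oracle_of W'"
  shows "freezes \<W> D W (coding_numbers \<inter> {..<Suc N})"
  using assms unfolding freezes_def by (fastforce simp: agree_on_def less_Suc_eq)

text \<open>Going through the coding numbers in increasing order, each one that can still be made true is
  made true and is kept true by fixing the queries of one accepting run; the others are false for
  every remaining choice of \<open>W\<close>.\<close>

lemma exists_freezing_set:
  assumes "\<W> \<noteq> {}"
  shows "N \<le> 2 ^ L \<Longrightarrow> \<exists>W\<in>\<W>. \<exists>D. finite D \<and> card D \<le> L * card (coding_numbers \<inter> {..<N}) \<and>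
    freezes \<W> D W (coding_numbers \<inter> {..<N})"
proof (induction N)
  case 0
  obtain W where "W \<in> \<W>" using assms by blast
  then show ?case by (intro bexI[of _ W] exI[of _ "{}"]) (auto simp: freezes_def agree_on_def)
next
  case (Suc N)
  then obtain W D where member: "W \<in> \<W>"
    and small: "finite D" "card D \<le> L * card (coding_numbers \<inter> {..<N})"
    and frozen: "freezes \<W> D W (coding_numbers \<inter> {..<N})" by auto
  show ?case
  proof (cases "N \<in> coding_numbers \<and> (\<exists>W1\<in>\<W>. agree_on D W W1 \<and> N \<in> oracle_of W1)")
    case True
    then obtain W1 where true_at: "W1 \<in> \<W>" "agree_on D W W1" "N \<in> oracle_of W1" by blast
    moreover have "N < 2 ^ L" using Suc.prems by simp
    ultimately obtain Q where queries: "finite Q" "card Q \<le> L" "Q \<subseteq> {..<N}"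
      "\<And>W'. agree_on Q (oracle_of W1) (oracle_of W') \<Longrightarrow> N \<in> oracle_of W'"
      using coding_number_certificate True by blast
    have "coding_numbers \<inter> {..<Suc N} = insert N (coding_numbers \<inter> {..<N})" using True by auto
    then have "card (D \<union> Q) \<le> L * card (coding_numbers \<inter> {..<Suc N})"
      using small(2) queries(2) card_Un_le[of D Q] by simp
    then show ?thesis
      using true_at(1) small(1) queries(1) freezes_Suc_true[OF frozen true_at queries(3,4)] by blast
  next
    case False
    have "card (coding_numbers \<inter> {..<N}) \<le> card (coding_numbers \<inter> {..<Suc N})"
      by (rule card_mono) auto
    then have "card D \<le> L * card (coding_numbers \<inter> {..<Suc N})"
      using small(2) by (meson le_trans mult_le_mono2)
    moreover have "freezes \<W> D W (coding_numbers \<inter> {..<Suc N})"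
      using False by (intro freezes_Suc_false[OF frozen member]) blast
    ultimately show ?thesis using member small(1) by blast
  qed
qed

corollary exists_small_freezing_set:
  assumes "\<W> \<noteq> {}"
  obtains W D where "W \<in> \<W>" "finite D" "card D \<le> L * (L * L)"
    "freezes \<W> D W (coding_numbers \<inter> {..<2 ^ L})"
  using exists_freezing_set[OF assms order_refl, of L] card_coding_numbers_le[of L]
  by (meson le_trans mult_le_mono2)

section \<open>Witnesses and their sides\<close>

text \<open>A candidate for a complete pair is given by the indices of two machines and an exponent for
  their common clock; the components of the pair are the complements of the two languages.\<close>

type_synonym candidate = "(bool \<Rightarrow> nat) \<times> nat"

definition pair_machine :: "candidate \<Rightarrow> bool \<Rightarrow> machine" where
  "pair_machine a s = nth_machine (fst a s)"

lemma oracle_machine_pair_machine: "oracle_machine (pair_machine a s)"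
  by (simp add: pair_machine_def oracle_machine_nth_machine)

definition witness :: "candidate \<Rightarrow> bool \<Rightarrow> nat \<Rightarrow> bool list \<Rightarrow> nat" where
  "witness a s x y = tagged (4 * to_nat a + 2 * of_bool s) (splice (bits x) y)"

definition witnesses :: "candidate \<Rightarrow> nat \<Rightarrow> nat set" where
  "witnesses a x = {witness a s x y | s y. length y = bit_length x}"

definition unwitnessed :: "candidate \<Rightarrow> bool \<Rightarrow> nat set \<Rightarrow> nat set" where
  "unwitnessed a s V = {x. \<forall>y. length y = bit_length x \<longrightarrow> witness a s x y \<notin> V}"

definition fully_witnessed :: "candidate \<Rightarrow> nat set \<Rightarrow> bool" where
  "fully_witnessed a W \<longleftrightarrow> (\<forall>x. witnesses a x \<inter> W \<noteq> {})"

lemma witness_inject: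
  assumes "length y = bit_length x" "length y' = bit_length x'"
  shows "witness a s x y = witness a' s' x' y' \<longleftrightarrow> a = a' \<and> s = s' \<and> x = x' \<and> y = y'"
proof
  assume "witness a s x y = witness a' s' x' y'"
  then have tags: "4 * to_nat a + 2 * of_bool s = 4 * to_nat a' + 2 * of_bool s'"
    and words: "splice (bits x) y = splice (bits x') y'" by (simp_all add: witness_def)
  have "to_nat a = to_nat a' \<and> s = s'" using tags by (cases s; cases s'; simp; presburger)
  then show "a = a' \<and> s = s' \<and> x = x' \<and> y = y'"
    using words assms by (simp add: splice_eq_splice_iff)
qed simp

lemma witnesses_disjoint: "(a, x) \<noteq> (a', x') \<Longrightarrow> witnesses a x \<inter> witnesses a' x' = {}"
  by (auto simp: witnesses_def witness_inject)

lemma witness_notin_coding_numbers: "witness a s x y \<notin> coding_numbers"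
proof
  assume "witness a s x y \<in> coding_numbers"
  then obtain e r where "4 * to_nat a + 2 * of_bool s = 2 * prod_encode (e, r) + 1"
    unfolding coding_numbers_def witness_def coding_def padded_def by auto
  then show False by (cases s; simp; presburger)
qed

lemma witness_mem_oracle_of: "witness a s x y \<in> oracle_of W \<longleftrightarrow> witness a s x y \<in> W"
  by (simp add: noncoding_mem_oracle_of witness_notin_coding_numbers)

lemma witnesses_bounds:
  assumes "u \<in> witnesses a x"
  shows "bit_length x < u" "u < 2 ^ (4 * to_nat a + 4 + 2 * bit_length x)"
proof -
  obtain s y where witness: "u = witness a s x y" and length: "length y = bit_length x"
    using assms unfolding witnesses_def by blast
  let ?k = "4 * to_nat a + 2 * of_bool s" and ?w = "splice (bits x) y"
  have "bit_length x \<le> ?k + 1 + length ?w" by simp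
  also have "\<dots> < 2 ^ (?k + 1 + length ?w)" by (rule less_exp)
  also have "\<dots> \<le> u" unfolding witness witness_def by (rule tagged_ge)
  finally show "bit_length x < u" .
  have "u < 2 ^ (?k + 2 + length ?w)" unfolding witness witness_def by (rule tagged_less)
  also have "\<dots> \<le> 2 ^ (4 * to_nat a + 4 + 2 * bit_length x)"
    by (rule power_increasing) (use length in auto)
  finally show "u < 2 ^ (4 * to_nat a + 4 + 2 * bit_length x)" .
qed

lemma unwitnessed_in_CoNP: "unwitnessed a s V \<in> CoNP V"
proof -
  let ?k = "4 * to_nat a + 2 * of_bool s"
  have "- unwitnessed a s V = {x. accepts (guess_machine ?k) V x}"
    by (auto simp: unwitnessed_def accepts_guess_machine_iff witness_def)
  moreover obtain c where "runs_in_time (guess_machine ?k) V (clock c)"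
    using guess_machine_poly_time by blast
  ultimately show ?thesis
    unfolding CoNP_def NP_def NTIME_def clock_def using oracle_machine_guess_machine by blast
qed

lemma disjoint_CoNP_pair_unwitnessed:
  assumes "fully_witnessed a W"
  shows "disjoint_CoNP_pair (oracle_of W)
    (unwitnessed a False (oracle_of W), unwitnessed a True (oracle_of W))"
proof -
  have "x \<notin> unwitnessed a False (oracle_of W) \<or> x \<notin> unwitnessed a True (oracle_of W)" for x
  proof -
    obtain s y where "length y = bit_length x" "witness a s x y \<in> W"
      using assms unfolding fully_witnessed_def witnesses_def by blast
    then show ?thesis by (cases s) (auto simp: unwitnessed_def witness_mem_oracle_of)
  qed
  then show ?thesis by (auto simp: disjoint_CoNP_pair_def unwitnessed_in_CoNP)
qed

lemma exists_member_disjoint_from: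
  assumes "finite D" "disjoint_family_on F I" "card D < card I"
  shows "\<exists>i\<in>I. F i \<inter> D = {}"
proof (rule ccontr)
  assume "\<not> ?thesis"
  then have "\<forall>i\<in>I. \<exists>u. u \<in> F i \<inter> D" by blast
  then obtain f where chosen: "\<And>i. i \<in> I \<Longrightarrow> f i \<in> F i \<inter> D" by metis
  then have "inj_on f I"
    using assms(2) unfolding disjoint_family_on_def by (intro inj_onI) (metis IntD1 IntI empty_iff)
  then have "card I \<le> card D" using chosen assms(1) by (intro card_inj_on_le) auto
  then show False using assms(3) by simp
qed

lemma exists_fresh_witness:
  assumes "finite D" "card D < 2 ^ bit_length x"
  obtains y where "length y = bit_length x" "witness a s x y \<notin> D"
proof -
  let ?Y = "{y :: bool list. length y = bit_length x}"
  have "card ?Y = 2 ^ bit_length x"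
    using card_lists_length_eq[of "UNIV :: bool set" "bit_length x"] by simp
  moreover have "disjoint_family_on (\<lambda>y. {witness a s x y}) ?Y"
    by (auto simp: disjoint_family_on_def witness_inject)
  ultimately have "\<exists>y\<in>?Y. {witness a s x y} \<inter> D = {}"
    using assms by (intro exists_member_disjoint_from) auto
  then show thesis using that by blast
qed

lemma exists_fresh_input:
  assumes "finite D" "card D < 2 ^ n"
  obtains x where "bit_length x = Suc n" "witnesses a x \<inter> D = {}"
proof -
  have "disjoint_family_on (witnesses a) {2 ^ n..<2 ^ Suc n}"
    using witnesses_disjoint unfolding disjoint_family_on_def by blast
  then have "\<exists>x\<in>{2 ^ n..<2 ^ Suc n}. witnesses a x \<inter> D = {}"
    using assms by (intro exists_member_disjoint_from) auto
  then show thesis using that bit_length_eq_Suc_iff by blast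
qed

section \<open>Forcing conditions\<close>

definition components_meet :: "candidate \<Rightarrow> nat set \<Rightarrow> bool" where
  "components_meet a V \<longleftrightarrow>
     (\<exists>z. \<forall>s. \<not> accepts_within (pair_machine a s) V z (clock (snd a) (bit_length z)))"

text \<open>The extra step ensures that a machine that keeps to its clock is not cut off.\<close>

definition reduction_fails :: "candidate \<Rightarrow> nat \<Rightarrow> nat \<Rightarrow> nat set \<Rightarrow> bool" where
  "reduction_fails a e d V \<longleftrightarrow>
     (\<exists>x z s. clocked_output (nth_machine e) V x (Suc (clock d (bit_length x))) z \<and>
        x \<in> unwitnessed a s V \<and> accepts (pair_machine a s) V z)"

definition condition :: "nat set \<Rightarrow> nat \<Rightarrow> bool" where
  "condition W B \<longleftrightarrow> {B..} \<subseteq> W \<and>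
     (\<forall>a. fully_witnessed a W \<or> certifies {..<B} (oracle_of W) (components_meet a))"

lemma certifies_oracle_of_extend:
  assumes "certifies {..<B} (oracle_of W) \<Phi>" "agree_on {..<B} W W'" "B \<le> B'"
  shows "certifies {..<B'} (oracle_of W') \<Phi>"
  using certifies_mono[OF assms(1) _ agree_on_lessThan_oracle_of[OF assms(2)]] assms(3) by simp

lemma certifies_components_meet:
  assumes "\<And>s. \<not> accepts_within (pair_machine a s) V z (clock (snd a) (bit_length z))"
    and "clock (snd a) (bit_length z) \<le> l"
  shows "certifies {..<2 ^ l} V (components_meet a)"
  unfolding certifies_def components_meet_def
proof (intro allI impI exI[of _ z])
  fix V' s assume agree: "agree_on {..<2 ^ l} V V'"
  let ?T = "clock (snd a) (bit_length z)"
  have "{..<2 ^ ?T} \<subseteq> {..<2 ^ l :: nat}" using assms(2) by simp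
  with agree have "agree_on {..<2 ^ ?T} V V'" by (rule agree_on_subset)
  then show "\<not> accepts_within (pair_machine a s) V' z ?T"
    using accepts_within_cong[OF oracle_machine_pair_machine] assms(1) by blast
qed

definition witness_level :: "candidate \<Rightarrow> nat \<Rightarrow> nat set" where
  "witness_level a m = (\<Union>x\<in>{x. bit_length x = m}. witnesses a x)"

lemma witness_level_bounds:
  assumes "B \<le> m" "4 * to_nat a + 4 + 2 * m \<le> l"
  shows "witness_level a m \<subseteq> {B..<2 ^ l}"
proof
  fix u assume "u \<in> witness_level a m"
  then obtain x where input: "bit_length x = m" "u \<in> witnesses a x"
    unfolding witness_level_def by blast
  have "u < 2 ^ (4 * to_nat a + 4 + 2 * m)" using witnesses_bounds(2)[OF input(2)] input(1) by simp
  also have "\<dots> \<le> 2 ^ l" using assms(2) by (rule power_increasing) simp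
  finally show "u \<in> {B..<2 ^ l}" using witnesses_bounds(1)[OF input(2)] input(1) assms(1) by simp
qed

lemma witnesses_disjoint_level:
  assumes "bit_length x \<noteq> m \<or> a \<noteq> b"
  shows "witnesses a x \<inter> witness_level b m = {}"
proof -
  have "witnesses a x \<inter> witnesses b x' = {}" if "bit_length x' = m" for x'
    using assms that by (intro witnesses_disjoint) auto
  then show ?thesis unfolding witness_level_def by blast
qed

lemma condition_change_level:
  assumes cond: "condition W B" and W': "agree_on (- witness_level a m) W W'"
    and level: "witness_level a m \<subseteq> {B..<B'}" "B \<le> B'"
    and "fully_witnessed a W' \<or> certifies {..<B'} (oracle_of W') (components_meet a)"
  shows "condition W' B'"
  unfolding condition_def
proof (intro conjI allI)
  have "{B'..} \<subseteq> W" using cond level(2) unfolding condition_def by auto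
  moreover have "agree_on {B'..} W W'" using W' by (rule agree_on_subset) (use level(1) in auto)
  ultimately show "{B'..} \<subseteq> W'" unfolding agree_on_def by blast
  have below: "agree_on {..<B} W W'" using W' by (rule agree_on_subset) (use level(1) in auto)
  fix b
  consider (changed) "b = a" | (witnessed) "b \<noteq> a" "fully_witnessed b W"
    | (forced) "certifies {..<B} (oracle_of W) (components_meet b)"
    using cond unfolding condition_def by blast
  then show "fully_witnessed b W' \<or> certifies {..<B'} (oracle_of W') (components_meet b)"
  proof cases
    case witnessed
    have "witnesses b x \<inter> W' \<noteq> {}" for x
      using witnessed W' witnesses_disjoint_level[of x m b a]
      unfolding fully_witnessed_def agree_on_def by blast
    then show ?thesis unfolding fully_witnessed_def by blast
  next
    case forced
    then show ?thesis using certifies_oracle_of_extend below level(2) by blast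
  qed (use assms(5) in simp)
qed

section \<open>Defeating one reduction\<close>

definition cleared :: "candidate \<Rightarrow> nat \<Rightarrow> nat \<Rightarrow> nat set \<Rightarrow> bool" where
  "cleared a l x W \<longleftrightarrow> witnesses a x \<inter> W = {} \<and>
     (\<forall>w\<in>witnesses a x.
        agree_on (coding_numbers \<inter> {..<2 ^ l}) (oracle_of W) (oracle_of (insert w W)))"

lemma freezes_imp_cleared:
  assumes "freezes \<W> D W0 (coding_numbers \<inter> {..<2 ^ l})" "agree_on D W0 W"
    and "witnesses a x \<inter> (D \<union> W) = {}" "W \<in> \<W>" "\<And>w. w \<in> witnesses a x \<Longrightarrow> insert w W \<in> \<W>"
  shows "cleared a l x W"
proof -
  have "agree_on (coding_numbers \<inter> {..<2 ^ l}) (oracle_of W) (oracle_of (insert w W))"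
    if "w \<in> witnesses a x" for w
  proof (rule agree_on_trans[OF agree_on_sym])
    have "agree_on D W0 (insert w W)" using assms(2,3) that unfolding agree_on_def by blast
    then show "agree_on (coding_numbers \<inter> {..<2 ^ l}) (oracle_of W0) (oracle_of (insert w W))"
      using assms(1) assms(5)[OF that] unfolding freezes_def by blast
    show "agree_on (coding_numbers \<inter> {..<2 ^ l}) (oracle_of W0) (oracle_of W)"
      using assms(1,2,4) unfolding freezes_def by blast
  qed
  then show ?thesis using assms(3) unfolding cleared_def by blast
qed

lemma witnesses_meet_if_other_input:
  assumes "{B..} \<subseteq> W" "fully_witnessed a W" "B \<le> n" "finite D" "card D < 2 ^ n"
    and "agree_on (- witness_level a n) W W'" "W - witnesses a x - D \<subseteq> W'" "x' \<noteq> x"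
  shows "witnesses a x' \<inter> W' \<noteq> {}"
proof (cases "bit_length x' = n")
  case True
  then obtain y where fresh: "length y = bit_length x'" "witness a True x' y \<notin> D"
    using exists_fresh_witness[of D x' a True] assms(4,5) by blast
  then have mem: "witness a True x' y \<in> witnesses a x'" unfolding witnesses_def by blast
  then have "witness a True x' y \<in> W"
    using witnesses_bounds(1)[OF mem] assms(1,3) True by auto
  then show ?thesis
    using mem fresh(2) assms(7,8) witnesses_disjoint[of a x' a x] by blast
next
  case False
  then have "agree_on (witnesses a x') W W'"
    using assms(6) witnesses_disjoint_level[of x' n a a] by (auto intro: agree_on_subset)
  then show ?thesis using assms(2) unfolding fully_witnessed_def agree_on_def by blast
qed

lemma exists_cleared_input:
  assumes tail: "{B..} \<subseteq> W" "fully_witnessed a W" and large: "B \<le> n" "l * (l * l) < 2 ^ n"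
  obtains x W' where "bit_length x = Suc n" "agree_on (- witness_level a (Suc n)) W W'"
    "cleared a l x W'" "\<And>x'. x' \<noteq> x \<Longrightarrow> witnesses a x' \<inter> W' \<noteq> {}"
proof -
  define \<W> where "\<W> = {W'. agree_on (- witness_level a (Suc n)) W W'}"
  have "\<W> \<noteq> {}" unfolding \<W>_def using agree_on_refl by blast
  then obtain W0 D where member: "W0 \<in> \<W>" and small: "finite D" "card D \<le> l * (l * l)"
    and frozen: "freezes \<W> D W0 (coding_numbers \<inter> {..<2 ^ l})" by (rule exists_small_freezing_set)
  have few: "card D < 2 ^ n" using small(2) large(2) by simp
  obtain x where fresh: "bit_length x = Suc n" "witnesses a x \<inter> D = {}"
    using exists_fresh_input[OF small(1) few] .
  have x_level: "witnesses a x \<subseteq> witness_level a (Suc n)"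
    using fresh(1) unfolding witness_level_def by blast
  define W' where "W' = W0 \<inter> D \<union> (W - witnesses a x - D)"
  have in_family: "W' \<in> \<W>" using member x_level unfolding \<W>_def W'_def agree_on_def by auto
  have "cleared a l x W'"
  proof (rule freezes_imp_cleared[OF frozen _ _ in_family])
    show "agree_on D W0 W'" unfolding W'_def agree_on_def by auto
    show "witnesses a x \<inter> (D \<union> W') = {}" using fresh(2) unfolding W'_def by blast
    show "insert w W' \<in> \<W>" if "w \<in> witnesses a x" for w
      using that in_family x_level unfolding \<W>_def agree_on_def by auto
  qed
  moreover have "witnesses a x' \<inter> W' \<noteq> {}" if "x' \<noteq> x" for x'
  proof (rule witnesses_meet_if_other_input[OF tail _ small(1) _ _ _ that])
    show "agree_on (- witness_level a (Suc n)) W W'" using in_family unfolding \<W>_def by blast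
    show "W - witnesses a x - D \<subseteq> W'" unfolding W'_def by blast
  qed (use few large(1) in auto)
  ultimately show thesis using that fresh(1) in_family unfolding \<W>_def by blast
qed

lemma cleared_agree_on_insert:
  assumes "cleared a l x W" "w \<in> witnesses a x" "w \<notin> Q" "Q \<subseteq> {..<2 ^ l}"
  shows "agree_on Q (oracle_of W) (oracle_of (insert w W))"
proof (rule agree_on_oracle_of)
  show "agree_on (Q \<inter> coding_numbers) (oracle_of W) (oracle_of (insert w W))"
    using assms(1,2,4) unfolding cleared_def by (auto intro: agree_on_subset)
  show "agree_on (Q - coding_numbers) W (insert w W)"
    using assms(3) unfolding agree_on_def by auto
qed

lemma unwitnessed_if_opposite_witness_inserted:
  assumes "witnesses a x \<inter> W = {}" "length y = bit_length x"
    and "agree_on (witnesses a x) (oracle_of (insert (witness a (\<not> s) x y) W)) V"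
  shows "x \<in> unwitnessed a s V"
proof -
  have "witness a s x y' \<notin> V" if "length y' = bit_length x" for y'
  proof -
    have mem: "witness a s x y' \<in> witnesses a x" using that unfolding witnesses_def by blast
    moreover have "witness a s x y' \<noteq> witness a (\<not> s) x y"
      using that assms(2) by (simp add: witness_inject)
    ultimately have "witness a s x y' \<notin> oracle_of (insert (witness a (\<not> s) x y) W)"
      using assms(1) unfolding witness_mem_oracle_of by blast
    then show ?thesis using assms(3) mem unfolding agree_on_def by blast
  qed
  then show ?thesis unfolding unwitnessed_def by blast
qed

lemma exists_witness_forcing_failure:
  assumes clear: "cleared a l x W" and below: "witnesses a x \<subseteq> {..<2 ^ l}"
    and out: "clocked_output (nth_machine e) (oracle_of W) x (Suc (clock d (bit_length x))) z"
    and acc: "accepts_within (pair_machine a s) (oracle_of W) z T"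
    and size: "Suc (clock d (bit_length x)) + T \<le> l" "l < 2 ^ bit_length x"
  obtains w where "w \<in> witnesses a x"
    "certifies {..<2 ^ l} (oracle_of (insert w W)) (reduction_fails a e d)"
proof -
  define t where "t = Suc (clock d (bit_length x))"
  obtain P where output_certificate:
      "small_certificate t P (oracle_of W) (\<lambda>V. clocked_output (nth_machine e) V x t z)"
    using exists_clocked_output_certificate[OF oracle_machine_nth_machine out]
    unfolding t_def by blast
  obtain Q where accept_certificate:
      "small_certificate T Q (oracle_of W) (\<lambda>V. accepts_within (pair_machine a s) V z T)"
    using exists_accepts_within_certificate[OF oracle_machine_pair_machine acc] by blast
  note certificates = output_certificate[unfolded small_certificate_def]
    accept_certificate[unfolded small_certificate_def]
  have "card (P \<union> Q) < 2 ^ bit_length x"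
    using card_Un_le[of P Q] certificates size unfolding t_def by linarith
  then obtain y where fresh: "length y = bit_length x" "witness a (\<not> s) x y \<notin> P \<union> Q"
    using exists_fresh_witness[of "P \<union> Q"] certificates by blast
  define w where "w = witness a (\<not> s) x y"
  have inserted: "w \<in> witnesses a x" using fresh(1) unfolding w_def witnesses_def by blast
  have "t \<le> l" "T \<le> l" using size(1) by (auto simp: t_def)
  then have "{..<2 ^ t} \<subseteq> {..<2 ^ l :: nat}" "{..<2 ^ T} \<subseteq> {..<2 ^ l :: nat}" by simp_all
  then have queries: "P \<union> Q \<subseteq> {..<2 ^ l}"
    using certificates by (meson Un_least order_trans)
  have same: "agree_on (P \<union> Q) (oracle_of W) (oracle_of (insert w W))"
    using cleared_agree_on_insert[OF clear inserted _ queries] fresh(2) unfolding w_def by blast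
  have "reduction_fails a e d V" if V: "agree_on {..<2 ^ l} (oracle_of (insert w W)) V" for V
  proof -
    have "agree_on (P \<union> Q) (oracle_of W) V"
      using same agree_on_subset[OF V queries] by (rule agree_on_trans)
    then have "clocked_output (nth_machine e) V x t z" "accepts_within (pair_machine a s) V z T"
      using certificates unfolding certifies_def by auto
    moreover have "x \<in> unwitnessed a s V"
      using clear fresh(1) agree_on_subset[OF V below] unfolding cleared_def w_def
      by (blast intro: unwitnessed_if_opposite_witness_inserted)
    ultimately show ?thesis
      unfolding reduction_fails_def t_def using accepts_within_imp_accepts by blast
  qed
  then show thesis using that inserted unfolding certifies_def by blast
qed

definition stage_bound :: "candidate \<Rightarrow> nat \<Rightarrow> nat \<Rightarrow> nat" where
  "stage_bound a d n =
     Suc (clock d n) + clock (snd a) (n + Suc (clock d n)) + (4 * to_nat a + 4 + 2 * n)"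

lemma exists_stage_length:
  obtains n l where "B \<le> n" "l = stage_bound a d (Suc n)" "l * (l * l) < 2 ^ n" "l < 2 ^ Suc n"
proof -
  let ?L = "stage_bound a d"
  have "poly_bounded ?L"
    unfolding stage_bound_def Suc_eq_plus1 by (intro poly_bounded_intros poly_bounded_clock)
  then have "poly_bounded (\<lambda>n. 2 * (?L n * (?L n * ?L n) + ?L n))" by (intro poly_bounded_intros)
  from poly_bounded_less_exp[OF this, of "Suc B"] obtain m
    where large: "Suc B \<le> m" "2 * (?L m * (?L m * ?L m) + ?L m) < 2 ^ m" by blast
  then obtain n where pred: "m = Suc n" by (cases m) auto
  have "?L m * (?L m * ?L m) + ?L m < 2 ^ n" using large(2) by (simp add: pred)
  then show thesis using large(1) by (intro that[of n "?L (Suc n)"]) (auto simp: pred)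
qed

lemma cleared_forces_requirement:
  assumes clear: "cleared a l x W" and below: "witnesses a x \<subseteq> {..<2 ^ l}"
    and size: "stage_bound a d (bit_length x) \<le> l" "l < 2 ^ bit_length x"
  shows "certifies {..<2 ^ l} (oracle_of W) (components_meet a) \<or>
    (\<exists>w\<in>witnesses a x. certifies {..<2 ^ l} (oracle_of (insert w W)) (reduction_fails a e d))"
proof -
  let ?t = "Suc (clock d (bit_length x))"
  obtain z where out: "clocked_output (nth_machine e) (oracle_of W) x ?t z"
    using exists_clocked_output by blast
  let ?T = "clock (snd a) (bit_length z)"
  have "?T \<le> clock (snd a) (bit_length x + ?t)"
    using bit_length_clocked_output[OF oracle_machine_nth_machine out] by (rule clock_mono)
  then have total: "?t + ?T \<le> l" using size(1) by (simp add: stage_bound_def)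
  show ?thesis
  proof (cases "\<exists>s. accepts_within (pair_machine a s) (oracle_of W) z ?T")
    case True
    then show ?thesis
      using exists_witness_forcing_failure[OF clear below out _ total size(2)] by blast
  next
    case False
    then show ?thesis using total by (intro disjI1 certifies_components_meet[of a _ z]) auto
  qed
qed

definition requirement :: "candidate \<times> nat \<times> nat \<Rightarrow> nat set \<Rightarrow> bool" where
  "requirement r V \<longleftrightarrow> (case r of (a, e, d) \<Rightarrow> components_meet a V \<or> reduction_fails a e d V)"

lemma cleared_extension_forcing_requirement:
  assumes "cleared a l x W" "witnesses a x \<subseteq> {..<2 ^ l}"
    and "stage_bound a d (bit_length x) \<le> l" "l < 2 ^ bit_length x"
    and others: "\<And>x'. x' \<noteq> x \<Longrightarrow> witnesses a x' \<inter> W \<noteq> {}"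
  obtains W' where "agree_on (- witnesses a x) W W'"
    "fully_witnessed a W' \<or> certifies {..<2 ^ l} (oracle_of W') (components_meet a)"
    "certifies {..<2 ^ l} (oracle_of W') (requirement (a, e, d))"
proof -
  consider (meet) "certifies {..<2 ^ l} (oracle_of W) (components_meet a)"
    | (fail) w where "w \<in> witnesses a x"
      "certifies {..<2 ^ l} (oracle_of (insert w W)) (reduction_fails a e d)"
    using cleared_forces_requirement[OF assms(1-4)] by blast
  then show thesis
  proof cases
    case meet
    then show thesis by (intro that[of W]) (auto simp: requirement_def certifies_def)
  next
    case (fail w)
    have "witnesses a x' \<inter> insert w W \<noteq> {}" for x' using fail(1) others by (cases "x' = x") auto
    moreover have "agree_on (- witnesses a x) W (insert w W)"
      using fail(1) unfolding agree_on_def by auto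
    ultimately show thesis
      using that fail(2) by (auto simp: fully_witnessed_def requirement_def certifies_def)
  qed
qed

lemma extension_forcing_requirement_if_fully_witnessed:
  assumes cond: "condition W B" and full: "fully_witnessed a W"
  obtains W' B' where "B < B'" "agree_on {..<B} W W'" "condition W' B'"
    "certifies {..<B'} (oracle_of W') (requirement (a, e, d))"
proof -
  obtain n l where large: "B \<le> n"
    and bound: "l = stage_bound a d (Suc n)" "l * (l * l) < 2 ^ n" "l < 2 ^ Suc n"
    by (rule exists_stage_length)
  let ?S = "witness_level a (Suc n)"
  have level: "?S \<subseteq> {B..<2 ^ l}"
    using large by (intro witness_level_bounds) (auto simp: bound(1) stage_bound_def)
  have "B < l" using large by (simp add: bound(1) stage_bound_def)
  then have "B < 2 ^ l" using less_exp[of l] by (rule less_trans)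
  have "{B..} \<subseteq> W" using cond unfolding condition_def by blast
  from exists_cleared_input[OF this full large bound(2)] obtain x W1
    where input: "bit_length x = Suc n" and change: "agree_on (- ?S) W W1"
      and clear: "cleared a l x W1"
      and others: "\<And>x'. x' \<noteq> x \<Longrightarrow> witnesses a x' \<inter> W1 \<noteq> {}" by blast
  have x_level: "witnesses a x \<subseteq> ?S" using input unfolding witness_level_def by blast
  then have "witnesses a x \<subseteq> {..<2 ^ l}" using level by auto
  from cleared_extension_forcing_requirement[OF clear this _ _ others, of d e] bound(1,3) input
  obtain W'
    where ext: "agree_on (- witnesses a x) W1 W'"
      and meet: "fully_witnessed a W' \<or> certifies {..<2 ^ l} (oracle_of W') (components_meet a)"
      and req: "certifies {..<2 ^ l} (oracle_of W') (requirement (a, e, d))" by auto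
  have total_change: "agree_on (- ?S) W W'" using change ext x_level unfolding agree_on_def by blast
  have "condition W' (2 ^ l)"
    using condition_change_level[OF cond total_change level _ meet] \<open>B < 2 ^ l\<close> by simp
  moreover have "agree_on {..<B} W W'"
    using total_change by (rule agree_on_subset) (use level in auto)
  ultimately show thesis using that \<open>B < 2 ^ l\<close> req by blast
qed

lemma exists_extension_forcing_requirement:
  assumes "condition W B"
  shows "\<exists>W' B'. B < B' \<and> agree_on {..<B} W W' \<and> condition W' B' \<and>
    certifies {..<B'} (oracle_of W') (requirement r)"
proof -
  obtain a e d where split: "r = (a, e, d)" by (cases r)
  show ?thesis
  proof (cases "fully_witnessed a W")
    case True
    then show ?thesis
      using extension_forcing_requirement_if_fully_witnessed[OF assms] unfolding split by metis
  next
    case False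
    have extend: "certifies {..<Suc B} (oracle_of W) \<Phi>" if "certifies {..<B} (oracle_of W) \<Phi>" for \<Phi>
      using certifies_oracle_of_extend[OF that agree_on_refl] by simp
    have "certifies {..<B} (oracle_of W) (components_meet a)"
      using False assms unfolding condition_def by blast
    then have "certifies {..<B} (oracle_of W) (requirement r)"
      by (auto simp: certifies_def requirement_def split)
    moreover have "condition W (Suc B)" using assms extend unfolding condition_def by auto
    ultimately show ?thesis using extend agree_on_refl by blast
  qed
qed

section \<open>The generic oracle\<close>

lemma exists_set_agreeing_with_chain:
  assumes "\<And>i. i \<le> B i" "\<And>i. B i \<le> B (Suc i)" "\<And>i. agree_on {..<B i} (W i) (W (Suc i))"
  obtains V where "\<And>i. agree_on {..<B i} (W i) V"
proof -
  have later: "i \<le> j \<Longrightarrow> agree_on {..<B i} (W i) (W j)" for i j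
  proof (induction j rule: dec_induct)
    case (step j)
    have "B i \<le> B j" using assms(2) step(1) by (rule lift_Suc_mono_le)
    then have "agree_on {..<B i} (W j) (W (Suc j))"
      using assms(3)[of j] by (auto intro: agree_on_subset)
    then show ?case using step.IH agree_on_trans by blast
  qed simp
  have "u \<in> W i \<longleftrightarrow> u \<in> W (Suc u)" if "u < B i" for u i
  proof (cases "i \<le> Suc u")
    case True
    then show ?thesis using later[of i "Suc u"] that by (simp add: agree_on_def)
  next
    case False
    then show ?thesis using later[of "Suc u" i] assms(1)[of "Suc u"] by (simp add: agree_on_def)
  qed
  then show thesis by (intro that[of "{u. u \<in> W (Suc u)}"]) (simp add: agree_on_def)
qed

lemma exists_generic_set:
  fixes R :: "'i::countable \<Rightarrow> nat set \<Rightarrow> nat \<Rightarrow> bool"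
  assumes start: "C W0 B0"
    and extend: "\<And>i W B. C W B \<Longrightarrow>
      \<exists>W' B'. B < B' \<and> agree_on {..<B} W W' \<and> C W' B' \<and> R i W' B'"
  obtains V where "\<And>n. \<exists>W B. n \<le> B \<and> agree_on {..<B} W V \<and> C W B"
    "\<And>i. \<exists>W B. agree_on {..<B} W V \<and> R i W B"
proof -
  have "\<exists>f. \<forall>k. (C (fst (f k)) (snd (f k)) \<and> k \<le> snd (f k)) \<and>
      (snd (f k) \<le> snd (f (Suc k)) \<and> agree_on {..<snd (f k)} (fst (f k)) (fst (f (Suc k))) \<and>
       R (from_nat k) (fst (f (Suc k))) (snd (f (Suc k))))"
  proof (rule dependent_nat_choice)
    show "\<exists>p. C (fst p) (snd p) \<and> 0 \<le> snd p" using start by (intro exI[of _ "(W0, B0)"]) simp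
  next
    fix p k assume p: "C (fst p) (snd p) \<and> k \<le> snd p"
    then obtain W B where "snd p < B" "agree_on {..<snd p} (fst p) W" "C W B" "R (from_nat k) W B"
      using extend by blast
    then show "\<exists>p'. (C (fst p') (snd p') \<and> Suc k \<le> snd p') \<and>
        (snd p \<le> snd p' \<and> agree_on {..<snd p} (fst p) (fst p') \<and> R (from_nat k) (fst p') (snd p'))"
      using p by (intro exI[of _ "(W, B)"]) auto
  qed
  then obtain f where chain: "\<And>k. C (fst (f k)) (snd (f k))" "\<And>k. k \<le> snd (f k)"
    "\<And>k. snd (f k) \<le> snd (f (Suc k))" "\<And>k. agree_on {..<snd (f k)} (fst (f k)) (fst (f (Suc k)))"
    "\<And>k. R (from_nat k) (fst (f (Suc k))) (snd (f (Suc k)))" by blast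
  obtain V where limit: "\<And>k. agree_on {..<snd (f k)} (fst (f k)) V"
    using exists_set_agreeing_with_chain[of "\<lambda>k. snd (f k)" "\<lambda>k. fst (f k)"] chain(2-4) by blast
  show thesis
  proof (rule that)
    show "\<exists>W B. n \<le> B \<and> agree_on {..<B} W V \<and> C W B" for n using chain(1,2) limit by blast
    show "\<exists>W B. agree_on {..<B} W V \<and> R i W B" for i
      using chain(5)[of "to_nat i"] limit by (metis from_nat_to_nat)
  qed
qed

lemma exists_generic_oracle:
  obtains W where "\<And>r. requirement r (oracle_of W)"
    "\<And>a. components_meet a (oracle_of W) \<or> fully_witnessed a W"
proof -
  have "witnesses a x \<noteq> {}" for a x
    using length_replicate unfolding witnesses_def by fastforce
  then have "condition UNIV 0" by (simp add: condition_def fully_witnessed_def)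
  then obtain W where chain: "\<And>n. \<exists>W' B. n \<le> B \<and> agree_on {..<B} W' W \<and> condition W' B"
    and forced: "\<And>r. \<exists>W' B. agree_on {..<B} W' W \<and> certifies {..<B} (oracle_of W') (requirement r)"
    using exists_generic_set[of condition UNIV 0
        "\<lambda>r W B. certifies {..<B} (oracle_of W) (requirement r)"]
      exists_extension_forcing_requirement by blast
  show thesis
  proof (rule that)
    show "requirement r (oracle_of W)" for r
      using forced[of r] certifiesD agree_on_lessThan_oracle_of by blast
  next
    fix a
    have "witnesses a x \<inter> W \<noteq> {}" if "\<not> components_meet a (oracle_of W)" for x
    proof -
      obtain W' B where large: "2 ^ (4 * to_nat a + 4 + 2 * bit_length x) \<le> B"
        and agree: "agree_on {..<B} W' W" and cond: "condition W' B" using chain by blast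
      have "fully_witnessed a W'"
        using cond that agree_on_lessThan_oracle_of[OF agree] certifiesD
        unfolding condition_def by blast
      then obtain u where witness: "u \<in> witnesses a x" "u \<in> W'"
        unfolding fully_witnessed_def by blast
      have "u < B" using witnesses_bounds(2)[OF witness(1)] large by (rule less_le_trans)
      then show ?thesis using witness agree unfolding agree_on_def by blast
    qed
    then show "components_meet a (oracle_of W) \<or> fully_witnessed a W"
      unfolding fully_witnessed_def by blast
  qed
qed

section \<open>Candidates for a complete pair\<close>

definition component :: "'a \<times> 'a \<Rightarrow> bool \<Rightarrow> 'a" where
  "component P s = (if s then snd P else fst P)"

definition represents :: "candidate \<Rightarrow> nat set \<Rightarrow> nat set \<times> nat set \<Rightarrow> bool" where
  "represents a V P \<longleftrightarrow> (\<forall>s. runs_in_time (pair_machine a s) V (clock (snd a)) \<and>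
     component P s = {x. \<not> accepts (pair_machine a s) V x})"

lemma CoNP_clocked:
  assumes "U \<in> CoNP V"
  shows "\<exists>e c. U = {x. \<not> accepts (nth_machine e) V x} \<and> runs_in_time (nth_machine e) V (clock c)"
proof -
  obtain M c
    where machine: "- U = {x. accepts M V x}" "oracle_machine M" "runs_in_time M V (clock c)"
    using assms unfolding CoNP_def NP_def NTIME_def clock_def by blast
  obtain e where "nth_machine e = M" using nth_machine_surj[OF machine(2)] .
  then show ?thesis using machine(1,3) by blast
qed

lemma disjoint_CoNP_pair_represented:
  assumes "disjoint_CoNP_pair V P"
  obtains a where "represents a V P"
proof -
  have "component P s \<in> CoNP V" for s
    using assms by (simp add: disjoint_CoNP_pair_def component_def)
  then have "\<forall>s. \<exists>e c. component P s = {x. \<not> accepts (nth_machine e) V x} \<and>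
      runs_in_time (nth_machine e) V (clock c)"
    using CoNP_clocked by blast
  then obtain e c where languages: "\<And>s. component P s = {x. \<not> accepts (nth_machine (e s)) V x}"
    and time: "\<And>s. runs_in_time (nth_machine (e s)) V (clock (c s))" by metis
  define m where "m = max (c False) (c True)"
  have "c s \<le> m" for s by (cases s) (auto simp: m_def)
  then have "runs_in_time (nth_machine (e s)) V (clock m)" for s
    using time[of s] clock_mono_exponent unfolding runs_in_time_def by (meson le_trans)
  then have "represents (e, m) V P" using languages by (simp add: represents_def pair_machine_def)
  then show thesis by (rule that)
qed

lemma represents_not_components_meet:
  assumes "represents a V P" "fst P \<inter> snd P = {}"
  shows "\<not> components_meet a V"
proof
  assume "components_meet a V"
  then obtain z where
    "\<And>s. \<not> accepts_within (pair_machine a s) V z (clock (snd a) (bit_length z))"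
    unfolding components_meet_def by blast
  then have "z \<in> component P s" for s
    using assms(1) accepts_within_iff[OF _ order_refl] unfolding represents_def by blast
  from this[of False] this[of True] show False using assms(2) by (auto simp: component_def)
qed

lemma poly_reducible_reduction_succeeds:
  assumes "poly_reducible V (unwitnessed a False V, unwitnessed a True V) P" "represents a V P"
  shows "\<exists>e d. \<not> reduction_fails a e d V"
proof -
  obtain f where poly_time: "poly_time_computable V f"
    and red: "\<And>s x. x \<in> unwitnessed a s V \<Longrightarrow> f x \<in> component P s"
    using assms(1) unfolding poly_reducible_def component_def by (auto split: if_splits) metis
  obtain M d where machine: "oracle_machine M" "deterministic M" "runs_in_time M V (clock d)"
    and out: "\<And>x. \<exists>c. reaches M V x c \<and> halted M V c \<and> tape_number (snd c ! 0) = f x"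
    using poly_time unfolding poly_time_computable_def clock_def by blast
  obtain e where index: "nth_machine e = M" using nth_machine_surj[OF machine(1)] .
  have "z = f x" if "clocked_output M V x (Suc (clock d (bit_length x))) z" for x z
    using clocked_output_unique[OF machine(2,3) lessI] out[of x] that by metis
  then have "\<not> reduction_fails a e d V"
    using red assms(2) unfolding reduction_fails_def represents_def index by blast
  then show ?thesis by blast
qed

theorem theorem5p1:
  "\<exists>V :: nat set. (\<nexists>P. complete_disjoint_CoNP_pair V P) \<and> E V = NE V"
proof -
  obtain W where req: "\<And>r. requirement r (oracle_of W)"
    and witnessed: "\<And>a. components_meet a (oracle_of W) \<or> fully_witnessed a W"
    using exists_generic_oracle by blast
  let ?V = "oracle_of W"
  have "\<not> complete_disjoint_CoNP_pair ?V P" for P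
  proof
    assume complete: "complete_disjoint_CoNP_pair ?V P"
    then have pair: "disjoint_CoNP_pair ?V P" by (simp add: complete_disjoint_CoNP_pair_def)
    then obtain a where represented: "represents a ?V P" by (rule disjoint_CoNP_pair_represented)
    have disjoint: "\<not> components_meet a ?V"
      using represents_not_components_meet[OF represented] pair
      by (simp add: disjoint_CoNP_pair_def)
    then have "disjoint_CoNP_pair ?V (unwitnessed a False ?V, unwitnessed a True ?V)"
      using witnessed disjoint_CoNP_pair_unwitnessed by blast
    then have "poly_reducible ?V (unwitnessed a False ?V, unwitnessed a True ?V) P"
      using complete by (simp add: complete_disjoint_CoNP_pair_def)
    then obtain e d where "\<not> reduction_fails a e d ?V"
      using poly_reducible_reduction_succeeds[OF _ represented] by blast
    then show False using req[of "(a, e, d)"] disjoint by (simp add: requirement_def)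
  qed
  then show ?thesis using E_subset_NE NE_subset_E_oracle_of by blast
qed

end
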